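(* Let $\rho\in(0,1)$. Among all permutons $\gamma$ with $\rho_{12}(\gamma)=\rho$, the entropy-maximizing one has probability density $$g(x,y)=\frac{r(1-e^{-r})}{\left(e^{r(1-x-y)/2}-e^{r(x-y-1)/2}-e^{r(y-x-1)/2}+e^{r(x+y-1)/2}\right)^2},$$ where $r\in\mathbb R$ is the function of $\rho$ determined by $\rho=\rho(r)$, with $$\rho(r)=\frac{r\left(r-2\log(1-e^r)+2\right)-2\,\mathrm{Li}_2(e^r)}{r^2}+\frac{\pi^2}{3r^2}.$$
   Context: A permuton is a Borel probability measure $\gamma$ on $[0,1]^2$ with uniform marginals. $\rho_{12}(\gamma)$ is the probability that two points $(x_1,y_1),(x_2,y_2)$ selected independently from $\gamma$ are in the same order in both coordinates ($x_1<x_2$ and $y_1<y_2$, or $x_2<x_1$ and $y_2<y_1$). The entropy of a permuton $\gamma$ with density $g$ is $H(\gamma)=\int_{[0,1]^2}-g\log g\,dx\,dy\in[-\infty,0]$ (with $0\log0=0$), and $H(\gamma)=-\infty$ if $\gamma$ has no density. $\mathrm{Li}_2$ is the dilogarithm, $\mathrm{Li}_2(z)=-\int_0^z\frac{\log(1-u)}{u}\,du$. For $r>0$, $\log(1-e^r)$ and $\mathrm{Li}_2(e^r)$ are taken on the same side of the branch cut $[1,\infty)$ of the variable $z=e^r$ (the imaginary parts cancel). For $r=0$ the formulas are understood as limits $r\to0$, giving $\rho(0)=1/2$ and $g\equiv1$. *)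

theory Defs
  imports "HOL-Probability.Probability" "HOL-Complex_Analysis.Complex_Analysis"
begin

section \<open>Permutons\<close>

abbreviation unit_square :: "(real \<times> real) set" where
  "unit_square \<equiv> {0..1} \<times> {0..1}"

abbreviation lborel_square :: "(real \<times> real) measure" where
  "lborel_square \<equiv> restrict_space lborel unit_square"

definition permuton :: "(real \<times> real) measure \<Rightarrow> bool" where
  "permuton \<gamma> \<longleftrightarrow>
     prob_space \<gamma> \<and>
     sets \<gamma> = sets (restrict_space borel unit_square) \<and>
     distr \<gamma> borel fst = uniform_measure lborel {0..1} \<and>
     distr \<gamma> borel snd = uniform_measure lborel {0..1}"

definition rho12 :: "(real \<times> real) measure \<Rightarrow> real" where
  "rho12 \<gamma> = measure (\<gamma> \<Otimes>\<^sub>M \<gamma>)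
     {((x1, y1), (x2, y2)) \<in> space (\<gamma> \<Otimes>\<^sub>M \<gamma>).
        (x1 < x2 \<and> y1 < y2) \<or> (x2 < x1 \<and> y2 < y1)}"

section \<open>Entropy\<close>

definition has_density :: "(real \<times> real) measure \<Rightarrow> (real \<times> real \<Rightarrow> real) \<Rightarrow> bool" where
  "has_density \<gamma> g \<longleftrightarrow>
     g \<in> borel_measurable lborel_square \<and>
     (\<forall>p\<in>unit_square. 0 \<le> g p) \<and>
     \<gamma> = density lborel_square (\<lambda>p. ennreal (g p))"

text \<open>The integral of \<open>- g log g\<close> with values in the extended reals, as positive part minus
  negative part (\<^term>\<open>ennreal\<close> truncates negative reals to \<open>0\<close>). The first
  term is finite since \<open>- t log t \<le> 1 / e\<close> for \<open>t \<ge> 0\<close>, so the difference is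
  never \<open>\<infinity> - \<infinity>\<close>; it is \<open>-\<infinity>\<close> when the second term is infinite.
  The Bochner integral would instead return \<open>0\<close> in that case.\<close>
definition density_entropy :: "(real \<times> real \<Rightarrow> real) \<Rightarrow> ereal" where
  "density_entropy g =
     enn2ereal (\<integral>\<^sup>+ p. ennreal (- g p * ln (g p)) \<partial>lborel_square) -
     enn2ereal (\<integral>\<^sup>+ p. ennreal (g p * ln (g p)) \<partial>lborel_square)"

definition permuton_entropy :: "(real \<times> real) measure \<Rightarrow> ereal" where
  "permuton_entropy \<gamma> =
     (if \<exists>g. has_density \<gamma> g then density_entropy (SOME g. has_density \<gamma> g) else - \<infinity>)"

lemma density_entropy_unique:
  assumes "has_density \<gamma> g" "has_density \<gamma> h"
  shows "density_entropy g = density_entropy h"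
proof -
  have g: "g \<in> borel_measurable lborel_square" "\<forall>p\<in>unit_square. 0 \<le> g p"
    and h: "h \<in> borel_measurable lborel_square" "\<forall>p\<in>unit_square. 0 \<le> h p"
    and eq: "density lborel_square (\<lambda>p. ennreal (g p)) = density lborel_square (\<lambda>p. ennreal (h p))"
    using assms by (auto simp: has_density_def)
  have "unit_square \<in> sets (lborel :: (real \<times> real) measure)"
    by (simp add: borel_closed closed_Times)
  then have sf: "sigma_finite_measure lborel_square"
    by (intro sigma_finite_measure_restrict_space sigma_finite_lborel) auto
  have "AE p in lborel_square. ennreal (g p) = ennreal (h p)"
    using sigma_finite_measure.density_unique_iff[OF sf] g(1) h(1) eq by simp
  with AE_space have ae: "AE p in lborel_square. g p = h p"
  proof eventually_elim
    case (elim p)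
    then have "p \<in> unit_square"
      by (simp add: space_restrict_space)
    then have "0 \<le> g p" "0 \<le> h p"
      using g(2) h(2) by blast+
    with elim(2) show ?case
      by simp
  qed
  have "(\<integral>\<^sup>+ p. ennreal (- g p * ln (g p)) \<partial>lborel_square) =
        (\<integral>\<^sup>+ p. ennreal (- h p * ln (h p)) \<partial>lborel_square)"
    using ae by (intro nn_integral_cong_AE) (auto elim: eventually_mono)
  moreover have "(\<integral>\<^sup>+ p. ennreal (g p * ln (g p)) \<partial>lborel_square) =
        (\<integral>\<^sup>+ p. ennreal (h p * ln (h p)) \<partial>lborel_square)"
    using ae by (intro nn_integral_cong_AE) (auto elim: eventually_mono)
  ultimately show ?thesis
    by (simp add: density_entropy_def)
qed

lemma permuton_entropy_eq:
  assumes "has_density \<gamma> g"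
  shows "permuton_entropy \<gamma> = density_entropy g"
  unfolding permuton_entropy_def
  using assms density_entropy_unique[OF someI[of "has_density \<gamma>", OF assms] assms] by auto

definition entropy_maximizer :: "real \<Rightarrow> (real \<times> real) measure \<Rightarrow> bool" where
  "entropy_maximizer \<rho> \<gamma> \<longleftrightarrow>
     permuton \<gamma> \<and> rho12 \<gamma> = \<rho> \<and>
     (\<forall>\<gamma>'. permuton \<gamma>' \<and> rho12 \<gamma>' = \<rho> \<longrightarrow> permuton_entropy \<gamma>' \<le> permuton_entropy \<gamma>)"

section \<open>The explicit formulas\<close>

text \<open>Integrating along the segment from \<open>0\<close> to \<open>z\<close> gives the principal branch off the cut
  \<open>[1,\<infinity>)\<close>. For real \<open>z > 1\<close> the segment runs along the cut, where
  \<^term>\<open>Ln\<close> of the negative real \<open>1 - u\<close> has imaginary part \<open>+\<pi>\<close>, that is, its limit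
  for \<open>u\<close> approaching the cut from the lower half plane. Hence on the cut both
  \<open>Ln (1 - z)\<close> and \<open>dilog z\<close> are the boundary values from below.\<close>
definition dilog :: "complex \<Rightarrow> complex" where
  "dilog z = - contour_integral (linepath 0 z) (\<lambda>u. Ln (1 - u) / u)"

text \<open>The values of the next two functions at \<open>r = 0\<close> are the limits for \<open>r \<rightarrow> 0\<close>.
  The first is complex-valued because its terms are not real for \<open>r > 0\<close>, although the imaginary
  parts cancel.\<close>
definition rho_param :: "real \<Rightarrow> complex" where
  "rho_param r =
     (if r = 0 then 1 / 2
      else let R = complex_of_real r in
        (R * (R - 2 * Ln (1 - exp R) + 2) - 2 * dilog (exp R)) / R\<^sup>2
        + (complex_of_real pi)\<^sup>2 / (3 * R\<^sup>2))"

definition max_density :: "real \<Rightarrow> real \<times> real \<Rightarrow> real" where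
  "max_density r = (\<lambda>(x, y).
     if r = 0 then 1
     else r * (1 - exp (- r)) /
       (exp (r * (1 - x - y) / 2) - exp (r * (x - y - 1) / 2)
        - exp (r * (y - x - 1) / 2) + exp (r * (x + y - 1) / 2))\<^sup>2)"

end

theory Submission
  imports Defs "HOL-Real_Asymp.Real_Asymp"
begin

text \<open>
  The constraint on \<open>rho12\<close> is an indefinite quadratic condition on the permuton, so concavity of the
  entropy alone does not give a maximizer. It becomes linear after a change of variables. Let \<open>g\<close> be
  the density of a permuton, \<open>G\<close> its distribution function and \<open>U(x,y) = \<integral>\<^sub>0\<^sup>x g(t,y) dt\<close>. If the points
  are inserted from left to right, then \<open>G(x,y) / x\<close> is the relative height at which a new point
  \<open>(x,y)\<close> enters among the earlier ones. The entropy of \<open>g\<close> is the integral over \<open>x\<close> of the entropies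
  of these insertion laws, and \<open>rho12\<close> equals \<open>2 \<integral> g G\<close>, an average of their means. For a
  prescribed mean of this kind the best insertion laws are truncated exponential.

  The proof carries this out without changing variables. Put \<open>E r s = \<integral>\<^sub>0\<^sup>s exp (- r t) dt\<close>. For
  every permuton density \<open>g\<close> the function \<open>h(x,y) = U(x,y) exp (- r G(x,y)) / E r x\<close> is
  again a probability density, because for fixed \<open>x\<close> the substitution \<open>s = G(x,y)\<close> has \<open>ds = U dy\<close>
  (lemmas \<open>nn_integral_cumul\<close> and \<open>nn_h\<close>). Gibbs' inequality bounds the entropy of \<open>g\<close> by
  \<open>- \<integral> g ln h\<close>. Here \<open>\<integral> g ln U = \<integral>\<^sub>0\<^sup>1 ln = - 1\<close> by the same substitution in the other variable, and the
  marginals are uniform, so the bound is \<open>1 + \<integral>\<^sub>0\<^sup>1 ln (E r x) dx + r rho12 / 2\<close>: it depends on \<open>r\<close> and on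
  \<open>rho12\<close> only (lemma \<open>entropy_bound\<close>).

  Equality holds iff \<open>g = h\<close> almost everywhere. Integrating this in \<open>y\<close> gives the differential equation
  \<open>\<partial>G/\<partial>x = E r G / E r x\<close> with \<open>G(1,y) = y\<close>. Its solutions satisfy
  \<open>E (-r) G \<cdot> E (-r) 1 = E (-r) x \<cdot> E (-r) y\<close>, so there is at most one (lemma \<open>extremal_unique\<close>); it is the
  Frank copula, whose density is \<open>max_density r\<close> (lemmas \<open>frank_extremal\<close> and \<open>max_density_eq\<close>).

  It remains to choose \<open>r\<close>. When \<open>g = h\<close>, the substitution also evaluates \<open>rho12\<close> as an average of means of
  truncated exponential laws. This is continuous and strictly decreasing in \<open>r\<close>, with limits \<open>1\<close> and
  \<open>0\<close>, which gives existence and uniqueness of \<open>r\<close> (lemma \<open>ex1_rho_real\<close>). An explicit antiderivative of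
  \<open>Ln (1 - u) / u\<close> on both sides of \<open>u = 1\<close> identifies it with \<open>rho_param\<close> (lemma \<open>rho_param_eq\<close>).
\<close>

section \<open>Distribution functions of densities on the line\<close>

definition cumul :: "(real \<Rightarrow> real) \<Rightarrow> real \<Rightarrow> real" where
  "cumul u y = enn2real (\<integral>\<^sup>+ t. ennreal (u t) * indicator {..y} t \<partial>lborel)"

lemma cumul_emeasure:
  assumes [measurable]: "u \<in> borel_measurable borel"
    and fin: "(\<integral>\<^sup>+ t. ennreal (u t) \<partial>lborel) < \<infinity>"
  shows "ennreal (cumul u y) = (\<integral>\<^sup>+ t. ennreal (u t) * indicator {..y} t \<partial>lborel)"
proof -
  have "(\<integral>\<^sup>+ t. ennreal (u t) * indicator {..y} t \<partial>lborel) \<le> (\<integral>\<^sup>+ t. ennreal (u t) \<partial>lborel)"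
    by (intro nn_integral_mono) (auto simp: indicator_def)
  then have "(\<integral>\<^sup>+ t. ennreal (u t) * indicator {..y} t \<partial>lborel) < top"
    using fin by (simp add: le_less_trans)
  then show ?thesis
    unfolding cumul_def by (rule ennreal_enn2real)
qed

lemma cumul_nonneg [simp]: "0 \<le> cumul u y"
  by (simp add: cumul_def)

text \<open>The probability integral transform, for densities of any finite mass \<open>m\<close>. The distribution function
need not be injective, so the law of \<open>F\<close> is found by squeezing: at a point \<open>a\<close> with \<open>F a = s\<close> the
mass \<open>s\<close> of \<open>{..a}\<close> lies between the masses of \<open>{F < s}\<close> and \<open>{F \<le> s}\<close>.\<close>

lemma distr_cumul:
  assumes u [measurable]: "u \<in> borel_measurable borel"
    and m: "(\<integral>\<^sup>+ t. ennreal (u t) \<partial>lborel) = ennreal m" "0 \<le> m"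
  shows "distr (density lborel (\<lambda>t. ennreal (u t))) borel (cumul u)
       = density lborel (indicator {0..m})"
    and "mono (cumul u)" and "continuous_on UNIV (cumul u)"
proof -
  define M where "M = density lborel (\<lambda>t. ennreal (u t))"
  have tot: "emeasure M UNIV = ennreal m"
    using m by (simp add: M_def emeasure_density)
  have setsM [measurable_cong, simp]: "sets M = sets borel" and spM [simp]: "space M = UNIV"
    by (simp_all add: M_def)
  have "finite_measure M"
    by (rule finite_measureI) (simp add: tot)
  then interpret finite_borel_measure M
    by (simp add: finite_borel_measure_def finite_borel_measure_axioms_def setsM)
  have cdf: "cumul u y = cdf M y" for y
    unfolding cumul_def cdf_def2 measure_def M_def by (subst emeasure_density) auto
  have totm: "measure M UNIV = m"
    using tot m(2) by (simp add: measure_def)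
  have pt: "measure M {x} = 0" for x
  proof -
    have "emeasure M {x} = (\<integral>\<^sup>+ t. ennreal (u t) * indicator {x} t \<partial>lborel)"
      by (simp add: M_def emeasure_density)
    also have "\<dots> = 0"
      using AE_lborel_singleton[of x] by (subst nn_integral_0_iff_AE) (auto elim!: eventually_mono)
    finally show ?thesis by (simp add: measure_def)
  qed
  have cont: "isCont (cumul u) x" for x
    using isCont_cdf[of x] pt[of x] cdf by (metis ext)
  then show contU: "continuous_on UNIV (cumul u)"
    by (simp add: continuous_at_imp_continuous_on)
  have le_m: "cumul u y \<le> m" for y
    using cdf_bounded[of y] by (simp add: cdf totm)
  have mon: "cumul u x \<le> cumul u y" if "x \<le> y" for x y
    using cdf_nondecreasing[OF that] by (simp add: cdf)
  then show "mono (cumul u)" by (simp add: mono_def)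
  have F [measurable]: "cumul u \<in> borel_measurable borel"
    using contU by (rule borel_measurable_continuous_onI)
  have ivt: "\<exists>a. cumul u a = s" if s: "0 < s" "s < m" for s
  proof -
    have "\<forall>\<^sub>F x in at_bot. cumul u x < s"
      using order_tendstoD(2)[OF cdf_lim_at_bot s(1)] unfolding cdf .
    then obtain a where a: "cumul u a < s" by (auto simp: eventually_at_bot_linorder)
    have "\<forall>\<^sub>F x in at_top. s < cumul u x"
      using order_tendstoD(1)[OF cdf_lim_at_top, of s] s totm unfolding cdf by simp
    then obtain b where b: "s < cumul u b" by (auto simp: eventually_at_top_linorder)
    have "a \<le> b" using mon[of b a] a b by linarith
    then show ?thesis
      using IVT'[of "cumul u" a s b] a b continuous_on_subset[OF contU subset_UNIV] by auto
  qed
  have ltle: "measure M {y. cumul u y < s} \<le> s" if s: "0 < s" "s < m" for s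
  proof -
    from ivt[OF s] obtain a where a: "cumul u a = s" by blast
    have "{y. cumul u y < s} \<subseteq> {..a}"
    proof
      fix y assume "y \<in> {y. cumul u y < s}"
      then show "y \<in> {..a}" using mon[of a y] a by (cases "y \<le> a") auto
    qed
    then have "measure M {y. cumul u y < s} \<le> measure M {..a}"
      by (intro finite_measure_mono) auto
    also have "\<dots> = s" using a by (simp add: cdf cdf_def2)
    finally show ?thesis .
  qed
  have eq: "measure M {y. cumul u y \<le> s} = s" if s: "0 \<le> s" "s < m" for s
  proof (rule antisym)
    show "measure M {y. cumul u y \<le> s} \<le> s"
    proof (rule dense_ge_bounded[OF s(2)])
      fix s' assume s': "s < s'" "s' < m"
      have "measure M {y. cumul u y \<le> s} \<le> measure M {y. cumul u y < s'}"
        using s' by (intro finite_measure_mono) auto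
      also have "\<dots> \<le> s'" using ltle[of s'] s s' by simp
      finally show "measure M {y. cumul u y \<le> s} \<le> s'" .
    qed
    show "s \<le> measure M {y. cumul u y \<le> s}"
    proof (cases "s = 0")
      case False
      then obtain a where a: "cumul u a = s" using ivt[of s] s by auto
      have "s = measure M {..a}" using a by (simp add: cdf cdf_def2)
      also have "\<dots> \<le> measure M {y. cumul u y \<le> s}"
        using mon a by (intro finite_measure_mono) auto
      finally show ?thesis .
    qed simp
  qed
  have gt: "emeasure M {y. s < cumul u y} = emeasure lborel ({s<..} \<inter> {0..m})" for s
  proof -
    consider "s < 0" | "0 \<le> s" "s < m" | "m \<le> s" by linarith
    then show ?thesis
    proof cases
      case 1
      then have "s < cumul u y" for y using cumul_nonneg[of u y] by linarith
      then have "{y. s < cumul u y} = UNIV" "{s<..} \<inter> {0..m} = {0..m}"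
        using 1 by auto
      then show ?thesis using m(2) tot by simp
    next
      case 2
      have "{y. s < cumul u y} = space M - {y. cumul u y \<le> s}" by auto
      then have "measure M {y. s < cumul u y} = measure M (space M - {y. cumul u y \<le> s})"
        by simp
      also have "\<dots> = m - s"
        using 2 eq[of s] totm by (subst finite_measure_compl) auto
      finally have "emeasure M {y. s < cumul u y} = ennreal (m - s)"
        by (simp add: emeasure_eq_measure)
      moreover have "{s<..} \<inter> {0..m} = {s<..m}" using 2 by auto
      ultimately show ?thesis using 2 by simp
    next
      case 3
      then have "\<not> s < cumul u y" for y using le_m[of y] by linarith
      then have "{y. s < cumul u y} = {}" "{s<..} \<inter> {0..m} = {}"
        using 3 by auto
      then show ?thesis by simp
    qed
  qed
  have "distr M borel (cumul u) = density lborel (indicator {0..m})"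
  proof (rule measure_eqI_lessThan)
    fix s :: real
    have e1: "emeasure (distr M borel (cumul u)) {s<..} = emeasure M {y. s < cumul u y}"
      by (subst emeasure_distr) (auto simp: vimage_def)
    then show "emeasure (distr M borel (cumul u)) {s<..} < \<infinity>"
      using emeasure_finite by (simp add: less_top[symmetric])
    have "emeasure (density lborel (indicator {0..m})) {s<..} = emeasure lborel ({s<..} \<inter> {0..m})"
      by (subst emeasure_density) (auto simp: Int_commute simp flip: indicator_inter_arith)
    with e1 gt show "emeasure (distr M borel (cumul u)) {s<..} = emeasure (density lborel (indicator {0..m})) {s<..}"
      by simp
  qed auto
  then show "distr (density lborel (\<lambda>t. ennreal (u t))) borel (cumul u) = density lborel (indicator {0..m})"
    by (simp add: M_def)
qed

text \<open>Substitution \<open>s = F t\<close>, \<open>ds = u t dt\<close> for the indefinite integral \<open>F\<close> of a density \<open>u\<close> that is merely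
measurable. All changes of variables in the argument are instances of this.\<close>

lemma nn_integral_cumul:
  assumes u [measurable]: "u \<in> borel_measurable borel"
    and fin: "(\<integral>\<^sup>+ t. ennreal (u t) \<partial>lborel) < \<infinity>"
    and f [measurable]: "f \<in> borel_measurable borel"
  shows "(\<integral>\<^sup>+ t. ennreal (u t) * f (cumul u t) * indicator {..b} t \<partial>lborel)
       = (\<integral>\<^sup>+ s. f s * indicator {0..cumul u b} s \<partial>lborel)"
proof -
  define v where "v t = u t * indicator {..b} t" for t
  have v [measurable]: "v \<in> borel_measurable borel" unfolding v_def by simp
  have ve: "ennreal (v t) = ennreal (u t) * indicator {..b} t" for t
    by (simp add: v_def indicator_def)
  have m: "(\<integral>\<^sup>+ t. ennreal (v t) \<partial>lborel) = ennreal (cumul u b)"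
    unfolding ve using cumul_emeasure[OF u fin, of b] by simp
  have cv: "cumul v t = cumul u t" if "t \<le> b" for t
    unfolding cumul_def ve using that
    by (intro arg_cong[where f=enn2real] nn_integral_cong) (auto split: split_indicator)
  note D = distr_cumul[OF v m cumul_nonneg]
  have [measurable]: "cumul v \<in> borel_measurable borel"
    using D(3) by (rule borel_measurable_continuous_onI)
  have "(\<integral>\<^sup>+ t. ennreal (u t) * f (cumul u t) * indicator {..b} t \<partial>lborel)
      = (\<integral>\<^sup>+ t. ennreal (v t) * f (cumul v t) \<partial>lborel)"
    using cv by (intro nn_integral_cong) (auto simp: ve split: split_indicator)
  also have "\<dots> = (\<integral>\<^sup>+ t. f (cumul v t) \<partial>density lborel (\<lambda>t. ennreal (v t)))"
    by (subst nn_integral_density) auto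
  also have "\<dots> = (\<integral>\<^sup>+ s. f s \<partial>distr (density lborel (\<lambda>t. ennreal (v t))) borel (cumul v))"
    by (subst nn_integral_distr) auto
  also have "\<dots> = (\<integral>\<^sup>+ s. f s * indicator {0..cumul u b} s \<partial>lborel)"
    unfolding D(1) by (subst nn_integral_density) (auto simp: mult.commute)
  finally show ?thesis .
qed

lemma measurable_cumul [measurable]:
  assumes [measurable]: "(\<lambda>(p, t). f p t) \<in> borel_measurable (N \<Otimes>\<^sub>M borel)" "b \<in> borel_measurable N"
  shows "(\<lambda>p. cumul (f p) (b p)) \<in> borel_measurable N"
proof -
  have "(\<lambda>(p, t). ennreal (f p t) * indicator {..b p} t) = (\<lambda>(p, t). if t \<le> b p then ennreal (f p t) else 0)"
    by (auto simp: fun_eq_iff)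
  also have "\<dots> \<in> borel_measurable (N \<Otimes>\<^sub>M lborel)"
    by measurable
  finally have [measurable]: "(\<lambda>(p, t). ennreal (f p t) * indicator {..b p} t) \<in> borel_measurable (N \<Otimes>\<^sub>M lborel)" .
  show ?thesis unfolding cumul_def by measurable
qed

lemma integrable_of_nn_integral:
  fixes u :: "'a \<Rightarrow> real"
  assumes "u \<in> borel_measurable M" "\<And>t. 0 \<le> u t" "(\<integral>\<^sup>+ t. ennreal (u t) \<partial>M) < \<infinity>"
  shows "integrable M u"
  using assms by (intro integrableI_nonneg) auto

lemma cumul_eq_integral:
  assumes [measurable]: "u \<in> borel_measurable borel" and nn: "\<And>t. 0 \<le> u t"
  shows "cumul u y = (\<integral>t. u t * indicator {..y} t \<partial>lborel)"
proof -
  have "(\<integral>t. u t * indicator {..y} t \<partial>lborel) = enn2real (\<integral>\<^sup>+ t. ennreal (u t * indicator {..y} t) \<partial>lborel)"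
    by (rule integral_eq_nn_integral) (use nn in auto)
  also have "(\<lambda>t. ennreal (u t * indicator {..y} t)) = (\<lambda>t. ennreal (u t) * indicator {..y} t)"
    using nn by (auto simp: fun_eq_iff split: split_indicator)
  finally show ?thesis by (simp add: cumul_def)
qed

lemma cumul_diff:
  assumes u [measurable]: "u \<in> borel_measurable borel" and nn: "\<And>t. 0 \<le> u t"
    and fin: "(\<integral>\<^sup>+ t. ennreal (u t) \<partial>lborel) < \<infinity>"
    and ab: "a \<le> b" and w: "continuous_on {a..b} w"
    and ae: "AE t in lborel. a < t \<longrightarrow> t < b \<longrightarrow> u t = w t"
  shows "cumul u b - cumul u a = integral {a..b} w"
proof -
  have iu: "integrable lborel u" using fin nn by (intro integrable_of_nn_integral) auto
  have i: "integrable lborel (\<lambda>t. u t * indicator {..c} t)" for c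
    using iu by (intro integrable_real_mult_indicator) auto
  have sw: "set_integrable lborel {a..b} w" using w by (rule borel_integrable_atLeastAtMost')
  have "cumul u b - cumul u a = (\<integral>t. u t * indicator {..b} t - u t * indicator {..a} t \<partial>lborel)"
    unfolding cumul_eq_integral[OF u nn] using i by simp
  also have "\<dots> = (\<integral>t. indicator {a..b} t *\<^sub>R w t \<partial>lborel)"
  proof (rule integral_cong_AE)
    show "(\<lambda>t. indicator {a..b} t *\<^sub>R w t) \<in> borel_measurable lborel"
      using sw unfolding set_integrable_def by (rule borel_measurable_integrable)
    show "AE t in lborel. u t * indicator {..b} t - u t * indicator {..a} t = indicator {a..b} t *\<^sub>R w t"
      using ae AE_lborel_singleton[of a] AE_lborel_singleton[of b]
      by eventually_elim (use ab in \<open>auto split: split_indicator\<close>)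
  qed auto
  also have "\<dots> = integral {a..b} w"
    using set_borel_integral_eq_integral(2)[OF sw] by (simp add: set_lebesgue_integral_def)
  finally show ?thesis .
qed

text \<open>A finite measure on the line is determined by its distribution function, and a density is
determined almost everywhere by its measure.\<close>

lemma AE_eq_of_cumul_eq:
  assumes [measurable]: "u \<in> borel_measurable borel" "w \<in> borel_measurable borel"
    and nn: "\<And>t. 0 \<le> u t" "\<And>t. 0 \<le> w t"
    and fin: "(\<integral>\<^sup>+ t. ennreal (u t) \<partial>lborel) < \<infinity>" "(\<integral>\<^sup>+ t. ennreal (w t) \<partial>lborel) < \<infinity>"
    and eq: "\<And>y. cumul u y = cumul w y"
  shows "AE t in lborel. u t = w t"
proof -
  have fbm: "finite_borel_measure (density lborel (\<lambda>t. ennreal (f t)))"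
    if [measurable]: "f \<in> borel_measurable borel" and "(\<integral>\<^sup>+ t. ennreal (f t) \<partial>lborel) < \<infinity>" for f :: "real \<Rightarrow> real"
  proof -
    have "finite_measure (density lborel (\<lambda>t. ennreal (f t)))"
      by (rule finite_measureI) (use that(2) in \<open>simp add: emeasure_density\<close>)
    then show ?thesis by (simp add: finite_borel_measure_def finite_borel_measure_axioms_def)
  qed
  have cdf: "cdf (density lborel (\<lambda>t. ennreal (f t))) = cumul f" if [measurable]: "f \<in> borel_measurable borel" for f :: "real \<Rightarrow> real"
    by (rule ext, unfold cumul_def cdf_def2 measure_def, subst emeasure_density) auto
  have "density lborel (\<lambda>t. ennreal (u t)) = density lborel (\<lambda>t. ennreal (w t))"
    using eq by (intro cdf_unique' fbm fin) (auto simp: cdf fun_eq_iff)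
  then have "AE t in lborel. ennreal (u t) = ennreal (w t)"
    by (subst (asm) sigma_finite_measure.density_unique_iff[OF sigma_finite_lborel]) auto
  then show ?thesis using nn by simp
qed

text \<open>The derivative is required in the open interval only, which admits integrands such as \<open>ln\<close> with a
singularity at an end point.\<close>

lemma nn_integral_FTC_Icc_interior:
  fixes f F :: "real \<Rightarrow> real"
  assumes f [measurable]: "f \<in> borel_measurable borel" and ab: "a \<le> b"
    and nn: "\<And>x. a < x \<Longrightarrow> x < b \<Longrightarrow> 0 \<le> f x"
    and c: "continuous_on {a..b} F"
    and d: "\<And>x. a < x \<Longrightarrow> x < b \<Longrightarrow> (F has_real_derivative f x) (at x)"
  shows "(\<integral>\<^sup>+ x. ennreal (f x) * indicator {a..b} x \<partial>lborel) = ennreal (F b - F a)"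
proof -
  have "(f has_integral (F b - F a)) {a..b}"
    using ab c by (rule fundamental_theorem_of_calculus_interior)
      (use d in \<open>auto simp: has_real_derivative_iff_has_vector_derivative\<close>)
  then have "((\<lambda>x. f x * indicator {a<..<b} x) has_integral (F b - F a)) {a..b}"
    by (rule has_integral_spike_finite[of "{a,b}", rotated -1]) (auto split: split_indicator)
  then have "((\<lambda>x. if x \<in> {a..b} then f x * indicator {a<..<b} x else 0) has_integral (F b - F a)) UNIV"
    by (simp only: has_integral_restrict_UNIV)
  also have "(\<lambda>x. if x \<in> {a..b} then f x * indicator {a<..<b} x else 0) = (\<lambda>x. f x * indicator {a<..<b} x)"
    by (auto split: split_indicator)
  finally have "integral\<^sup>N lborel (\<lambda>x. f x * indicator {a<..<b} x) = ennreal (F b - F a)"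
    by (intro nn_integral_has_integral_lborel) (use nn in \<open>auto split: split_indicator\<close>)
  moreover have "(\<integral>\<^sup>+ x. ennreal (f x) * indicator {a..b} x \<partial>lborel) = integral\<^sup>N lborel (\<lambda>x. f x * indicator {a<..<b} x)"
    by (rule nn_integral_cong_AE, use AE_lborel_singleton[of a] AE_lborel_singleton[of b] in eventually_elim)
      (auto split: split_indicator)
  ultimately show ?thesis by simp
qed

lemma nn_integral_neg_ln: "(\<integral>\<^sup>+ s. ennreal (- ln s) * indicator {0..1} s \<partial>lborel) = 1"
proof -
  have "(\<integral>\<^sup>+ s. ennreal (- ln s) * indicator {0..1} s \<partial>lborel) = ennreal ((1 - 1 * ln 1) - (0 - 0 * ln 0))"
  proof (rule nn_integral_FTC_Icc_interior)
    show "continuous_on {0..1} (\<lambda>s::real. s - s * ln s)"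
    proof -
      have "continuous (at s within {0..1}) (\<lambda>s::real. s * ln s)" if "s \<in> {0..1}" for s
      proof (cases "s = 0")
        case True
        have "((\<lambda>s::real. s * ln s) \<longlongrightarrow> 0) (at_right 0)" by real_asymp
        then have "((\<lambda>s::real. s * ln s) \<longlongrightarrow> 0) (at 0 within {0..1})"
          by (simp add: at_within_Icc_at_right)
        then show ?thesis by (simp add: True continuous_within)
      next
        case False
        with that show ?thesis by (intro continuous_intros) auto
      qed
      then have "continuous_on {0..1} (\<lambda>s::real. s * ln s)"
        by (simp add: continuous_on_eq_continuous_within)
      then show ?thesis by (intro continuous_on_diff continuous_on_id)
    qed
  next
    fix s :: real assume "0 < s" "s < 1"
    then show "((\<lambda>s. s - s * ln s) has_real_derivative - ln s) (at s)"
      by (auto intro!: derivative_eq_intros)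
  qed auto
  then show ?thesis by simp
qed

section \<open>Gibbs' inequality\<close>

text \<open>The shape of \<^const>\<open>density_entropy\<close> over an arbitrary measure.\<close>

definition entropy_of :: "'a measure \<Rightarrow> ('a \<Rightarrow> real) \<Rightarrow> ereal" where
  "entropy_of M g = enn2ereal (\<integral>\<^sup>+ p. ennreal (- g p * ln (g p)) \<partial>M)
     - enn2ereal (\<integral>\<^sup>+ p. ennreal (g p * ln (g p)) \<partial>M)"

lemma entropy_of_integrable:
  assumes int: "integrable M (\<lambda>p. g p * ln (g p))"
  shows "entropy_of M g = ereal (- (\<integral>p. g p * ln (g p) \<partial>M))"
proof -
  let ?f = "\<lambda>p. g p * ln (g p)"
  have fin: "(\<integral>\<^sup>+ p. ennreal (?f p) \<partial>M) \<noteq> \<infinity>" "(\<integral>\<^sup>+ p. ennreal (- ?f p) \<partial>M) \<noteq> \<infinity>"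
    using int unfolding real_integrable_def by auto
  obtain a where a: "(\<integral>\<^sup>+ p. ennreal (?f p) \<partial>M) = ennreal a" "0 \<le> a"
    using fin(1) by (cases "(\<integral>\<^sup>+ p. ennreal (?f p) \<partial>M)") auto
  obtain b where b: "(\<integral>\<^sup>+ p. ennreal (- ?f p) \<partial>M) = ennreal b" "0 \<le> b"
    using fin(2) by (cases "(\<integral>\<^sup>+ p. ennreal (- ?f p) \<partial>M)") auto
  show ?thesis
    unfolding entropy_of_def
    using a b by (simp add: real_lebesgue_integral_def[OF int])
qed

text \<open>This is \<open>ln z \<le> z - 1\<close> at \<open>z = h / g\<close>, with its equality case \<open>z = 1\<close>.\<close>

lemma gibbs_pointwise:
  fixes g h :: real
  assumes "0 \<le> g" "0 \<le> h" "0 < g \<Longrightarrow> 0 < h"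
  shows "0 \<le> (h - g) - (g * ln h - g * ln g)"
    and "(h - g) - (g * ln h - g * ln g) = 0 \<Longrightarrow> g = h"
proof -
  have *: "0 \<le> (h - g) - (g * ln h - g * ln g) \<and> ((h - g) - (g * ln h - g * ln g) = 0 \<longrightarrow> g = h)"
  proof (cases "g = 0")
    case False
    with assms have gh: "0 < g" "0 < h" by auto
    have le: "ln (h / g) \<le> h / g - 1" using gh by (intro ln_le_minus_one) simp
    have e: "(h - g) - (g * ln h - g * ln g) = g * ((h / g - 1) - ln (h / g))"
      using gh by (simp add: ln_div field_simps)
    have "0 \<le> g * ((h / g - 1) - ln (h / g))" using gh le by simp
    moreover have "g = h" if "g * ((h / g - 1) - ln (h / g)) = 0"
    proof -
      from that gh have "ln (h / g) = h / g - 1" by simp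
      then have "h / g = 1" using gh by (intro ln_eq_minus_one) auto
      then show ?thesis using gh by simp
    qed
    ultimately show ?thesis unfolding e by blast
  qed (use assms in auto)
  show "0 \<le> (h - g) - (g * ln h - g * ln g)" using * by blast
  show "(h - g) - (g * ln h - g * ln g) = 0 \<Longrightarrow> g = h" using * by blast
qed

text \<open>Integrate the pointwise inequality. It also gives \<open>- g ln g \<le> h - g - g ln h\<close> with integrable right-hand
side. Hence, if \<open>g ln g\<close> is not integrable, its positive part is to blame and the entropy is \<open>- \<infinity>\<close>.\<close>

lemma gibbs:
  assumes [measurable]: "g \<in> borel_measurable M" "h \<in> borel_measurable M"
    and nn: "\<And>p. 0 \<le> g p" "\<And>p. 0 \<le> h p"
    and int: "(\<integral>\<^sup>+ p. ennreal (g p) \<partial>M) = 1" "(\<integral>\<^sup>+ p. ennreal (h p) \<partial>M) = 1"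
    and ac: "AE p in M. 0 < g p \<longrightarrow> 0 < h p"
    and il: "integrable M (\<lambda>p. g p * ln (h p))"
  shows "entropy_of M g \<le> ereal (- (\<integral>p. g p * ln (h p) \<partial>M))" (is ?A)
    and "entropy_of M g = ereal (- (\<integral>p. g p * ln (h p) \<partial>M)) \<Longrightarrow> AE p in M. g p = h p" (is "?B1 \<Longrightarrow> ?B2")
proof -
  have ig: "integrable M g" "integral\<^sup>L M g = 1"
    using nn int by (auto intro!: integrableI_nonneg simp: integral_eq_nn_integral)
  have ih: "integrable M h" "integral\<^sup>L M h = 1"
    using nn int by (auto intro!: integrableI_nonneg simp: integral_eq_nn_integral)
  let ?d = "\<lambda>p. (h p - g p) - (g p * ln (h p) - g p * ln (g p))"
  have d0: "AE p in M. 0 \<le> ?d p"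
    using ac by eventually_elim (use gibbs_pointwise(1) nn in blast)
  have deq: "AE p in M. ?d p = 0 \<longrightarrow> g p = h p"
    using ac by eventually_elim (use gibbs_pointwise(2) nn in blast)
  have "?A \<and> (?B1 \<longrightarrow> ?B2)"
  proof (cases "integrable M (\<lambda>p. g p * ln (g p))")
    case True
    have id: "integrable M ?d" using True il ig ih by auto
    have val: "(\<integral>p. ?d p \<partial>M) = - (\<integral>p. g p * ln (h p) \<partial>M) + (\<integral>p. g p * ln (g p) \<partial>M)"
      using True il ig ih by simp
    have "0 \<le> (\<integral>p. ?d p \<partial>M)" using d0 by (rule integral_nonneg_AE)
    then have A: ?A unfolding entropy_of_integrable[OF True] val by simp
    have ?B2 if ?B1
    proof -
      from that have "(\<integral>p. ?d p \<partial>M) = 0" unfolding entropy_of_integrable[OF True] val by simp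
      then have "AE p in M. ?d p = 0"
        using integral_nonneg_eq_0_iff_AE[OF id d0] by simp
      with deq show ?thesis by eventually_elim blast
    qed
    with A show ?thesis by blast
  next
    case False
    have le: "(\<integral>\<^sup>+ p. ennreal (- g p * ln (g p)) \<partial>M) \<le> (\<integral>\<^sup>+ p. ennreal (\<bar>h p - g p - g p * ln (h p)\<bar>) \<partial>M)"
      using d0 by (intro nn_integral_mono_AE) (auto elim!: eventually_mono intro!: ennreal_leI)
    have "integrable M (\<lambda>p. h p - g p - g p * ln (h p))" using il ig ih by auto
    then have "(\<integral>\<^sup>+ p. ennreal (\<bar>h p - g p - g p * ln (h p)\<bar>) \<partial>M) < \<infinity>"
      unfolding integrable_iff_bounded by simp
    with le have fin: "(\<integral>\<^sup>+ p. ennreal (- g p * ln (g p)) \<partial>M) < \<infinity>" by (rule le_less_trans)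
    have "(\<integral>\<^sup>+ p. ennreal (g p * ln (g p)) \<partial>M) = \<infinity>"
      using False fin unfolding real_integrable_def by auto
    moreover obtain a where "(\<integral>\<^sup>+ p. ennreal (- g p * ln (g p)) \<partial>M) = ennreal a" "0 \<le> a"
      using fin by (cases "(\<integral>\<^sup>+ p. ennreal (- g p * ln (g p)) \<partial>M)") auto
    ultimately have "entropy_of M g = - \<infinity>" unfolding entropy_of_def by simp
    then show ?thesis by simp
  qed
  then show ?A and "?B1 \<Longrightarrow> ?B2" by blast+
qed

section \<open>The mean of a truncated exponential law\<close>

text \<open>The integrand of the Bose and Debye integrals; the values at \<open>0\<close> here and below make the functions
continuous.\<close>

definition bose :: "real \<Rightarrow> real" where
  "bose t = (if t = 0 then 1 else t / (exp t - 1))"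

text \<open>On \<open>[0,x]\<close>, the law with density proportional to \<open>exp (- r s)\<close> has mean \<open>x * trunc_mean (r * x)\<close>.\<close>

definition trunc_mean :: "real \<Rightarrow> real" where
  "trunc_mean t = (if t = 0 then 1 / 2 else 1 / t - 1 / (exp t - 1))"

lemma trunc_mean_bose: "t * trunc_mean t = 1 - bose t"
  by (simp add: trunc_mean_def bose_def right_diff_distrib)

lemma isCont_bose: "isCont bose t"
proof (cases "t = 0")
  case True
  have "((\<lambda>t::real. t / (exp t - 1)) \<longlongrightarrow> 1) (at 0)" by real_asymp
  then have "(bose \<longlongrightarrow> 1) (at 0)"
    by (rule tendsto_cong[THEN iffD1, rotated]) (auto simp: bose_def eventually_at_filter)
  then show ?thesis using True by (simp add: isCont_def bose_def[of 0])
next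
  case False
  have "isCont (\<lambda>t. t / (exp t - 1)) t" using False by (intro continuous_intros) auto
  moreover have "\<forall>\<^sub>F s in nhds t. bose s = s / (exp s - 1)"
    using False by (intro eventually_nhds[THEN iffD2] exI[of _ "- {0}"]) (auto simp: bose_def)
  ultimately show ?thesis by (subst isCont_cong) auto
qed

lemma isCont_trunc_mean: "isCont trunc_mean t"
proof (cases "t = 0")
  case True
  have "((\<lambda>t::real. 1 / t - 1 / (exp t - 1)) \<longlongrightarrow> 1/2) (at 0)" by real_asymp
  then have "(trunc_mean \<longlongrightarrow> 1/2) (at 0)"
    by (rule tendsto_cong[THEN iffD1, rotated]) (auto simp: trunc_mean_def eventually_at_filter)
  then show ?thesis using True by (simp add: isCont_def trunc_mean_def[of 0])
next
  case False
  have "isCont (\<lambda>t. 1 / t - 1 / (exp t - 1)) t" using False by (intro continuous_intros) auto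
  moreover have "\<forall>\<^sub>F s in nhds t. trunc_mean s = 1 / s - 1 / (exp s - 1)"
    using False by (intro eventually_nhds[THEN iffD2] exI[of _ "- {0}"]) (auto simp: trunc_mean_def)
  ultimately show ?thesis by (subst isCont_cong) auto
qed

lemma trunc_mean_minus: "trunc_mean (- t) = 1 - trunc_mean t"
proof (cases "t = 0")
  case False
  then have "exp t \<noteq> 1" by simp
  then have "1 / (exp (- t) - 1) = - 1 - 1 / (exp t - 1)"
    by (simp add: exp_minus field_simps)
  then show ?thesis using False by (simp add: trunc_mean_def)
qed (simp add: trunc_mean_def)

text \<open>Equivalent to \<open>sinh (t / 2) > t / 2\<close>; it is the sign of the derivative of \<^const>\<open>trunc_mean\<close>.\<close>

lemma sq_mult_exp_less:
  fixes t :: real assumes "0 < t" shows "t\<^sup>2 * exp t < (exp t - 1)\<^sup>2"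
proof -
  have "exp 0 - exp (-0) - 2 * 0 < exp (t/2) - exp (- (t/2)) - 2 * (t/2)"
  proof (rule DERIV_pos_imp_increasing_open[of 0 "t/2" "\<lambda>s. exp s - exp (- s) - 2 * s"])
    fix s :: real assume s: "0 < s" "s < t/2"
    have "(exp (s/2) - exp (-(s/2)))\<^sup>2 = exp s + exp (-s) - 2"
      by (simp add: power2_eq_square algebra_simps flip: exp_add)
    moreover have "exp (-(s/2)) < exp (s/2)" using s by simp
    then have "(exp (s/2) - exp (-(s/2)))\<^sup>2 > 0" by simp
    ultimately have "0 < exp s + exp (- s) - 2" by simp
    moreover have "((\<lambda>s. exp s - exp (- s) - 2 * s) has_real_derivative exp s + exp (- s) - 2) (at s)"
      by (auto intro!: derivative_eq_intros)
    ultimately show "\<exists>y. ((\<lambda>s. exp s - exp (- s) - 2 * s) has_real_derivative y) (at s) \<and> 0 < y" by blast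
  qed (use assms in \<open>auto intro!: continuous_intros\<close>)
  then have "t < exp (t/2) - exp (-(t/2))" by simp
  then have "t * exp (t/2) < (exp (t/2) - exp (-(t/2))) * exp (t/2)" by simp
  also have "\<dots> = exp t - 1" by (simp add: left_diff_distrib flip: exp_add)
  finally have "(t * exp (t/2))\<^sup>2 < (exp t - 1)\<^sup>2" using assms by (intro power_strict_mono) auto
  then show ?thesis by (simp add: power_mult_distrib flip: exp_double)
qed

text \<open>The derivative is computed away from \<open>0\<close> only. The half-line \<open>t \<ge> 0\<close> is treated first; the other one
follows by the symmetry \<open>trunc_mean_minus\<close>, which reflects the truncated law.\<close>

lemma trunc_mean_strict_antimono:
  assumes "a < b" shows "trunc_mean b < trunc_mean a"
proof -
  have pos: "trunc_mean b < trunc_mean a" if ab: "0 \<le> a" "a < b" for a b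
  proof (rule DERIV_neg_imp_decreasing_open[OF ab(2)])
    show "continuous_on {a..b} trunc_mean"
      using isCont_trunc_mean by (simp add: continuous_at_imp_continuous_on)
    fix t assume t: "a < t" "t < b"
    then have t0: "0 < t" using ab by simp
    have e1: "exp t \<noteq> 1" using t0 by simp
    have "((\<lambda>t. 1 / t - 1 / (exp t - 1)) has_real_derivative - (1 / t\<^sup>2) + exp t / (exp t - 1)\<^sup>2) (at t)"
      using t0 e1 by (auto intro!: derivative_eq_intros simp: power2_eq_square)
    then have "(trunc_mean has_real_derivative - (1 / t\<^sup>2) + exp t / (exp t - 1)\<^sup>2) (at t)"
      by (rule has_field_derivative_transform_within_open[of _ _ _ "{0<..}"])
        (use t0 in \<open>auto simp: trunc_mean_def\<close>)
    moreover have "- (1 / t\<^sup>2) + exp t / (exp t - 1)\<^sup>2 < 0"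
      using sq_mult_exp_less[OF t0] t0 e1 by (simp add: field_simps)
    ultimately show "\<exists>y. (trunc_mean has_real_derivative y) (at t) \<and> y < 0" by blast
  qed
  have neg: "trunc_mean b < trunc_mean a" if "b \<le> 0" "a < b" for a b
    using pos[of "-b" "-a"] that by (simp add: trunc_mean_minus)
  show ?thesis
  proof (cases "0 \<le> a \<or> b \<le> 0")
    case False
    then have "trunc_mean b < trunc_mean 0" "trunc_mean 0 < trunc_mean a"
      using pos[of 0 b] neg[of 0 a] by auto
    then show ?thesis by simp
  qed (use pos neg assms in auto)
qed

lemma trunc_mean_nonneg: "0 \<le> trunc_mean t"
proof (cases "0 < t")
  case True
  moreover have "t \<le> exp t - 1" using exp_ge_add_one_self[of t] by linarith
  ultimately have "1 / (exp t - 1) \<le> 1 / t"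
    by (intro divide_left_mono mult_pos_pos) auto
  then show ?thesis using True by (simp add: trunc_mean_def)
next
  case False
  then have "t = 0 \<or> t < 0" by auto
  then have "trunc_mean 0 \<le> trunc_mean t" using trunc_mean_strict_antimono[of t 0] by auto
  then show ?thesis by (simp add: trunc_mean_def)
qed

text \<open>The value of \<open>rho12\<close> at the maximizer with parameter \<open>r\<close>, before it is written with the dilogarithm.\<close>

definition rho_real :: "real \<Rightarrow> real" where
  "rho_real r = 2 * integral {0..1} (\<lambda>x. x * trunc_mean (r * x))"

lemma continuous_rho_integrand: "continuous_on S (\<lambda>x. x * trunc_mean (r * x))"
proof -
  have "continuous_on UNIV trunc_mean"
    using isCont_trunc_mean by (simp add: continuous_at_imp_continuous_on)
  from continuous_on_compose2[OF this, of S "\<lambda>x. r * x"] show ?thesis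
    by (intro continuous_on_mult continuous_on_id) (auto intro: continuous_intros)
qed

lemma rho_real_strict_antimono:
  assumes "r < r'" shows "rho_real r' < rho_real r"
proof -
  have "integral {0..1} (\<lambda>x. x * trunc_mean (r' * x)) < integral {0..1} (\<lambda>x. x * trunc_mean (r * x))"
  proof (intro integral_less_real continuous_rho_integrand)
    fix x :: real assume "x \<in> {0<..<1}"
    then have "trunc_mean (r' * x) < trunc_mean (r * x)" "0 < x"
      using assms by (auto intro!: trunc_mean_strict_antimono)
    then show "x * trunc_mean (r' * x) < x * trunc_mean (r * x)" by simp
  qed simp
  then show ?thesis by (simp add: rho_real_def)
qed

lemma continuous_rho_real: "continuous_on UNIV rho_real"
proof -
  have c: "continuous_on UNIV trunc_mean"
    using isCont_trunc_mean by (simp add: continuous_at_imp_continuous_on)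
  have "continuous_on (UNIV \<times> cbox 0 1) (\<lambda>p::real \<times> real. trunc_mean (fst p * snd p))"
    by (rule continuous_on_compose2[OF c]) (intro continuous_on_mult continuous_on_fst continuous_on_snd continuous_on_id, simp)
  then have "continuous_on UNIV (\<lambda>r. integral (cbox 0 1) (\<lambda>x. x * trunc_mean (r * x)))"
    by (intro integral_continuous_on_param) (auto simp: case_prod_unfold intro!: continuous_on_mult continuous_on_snd continuous_on_id)
  then show ?thesis
    unfolding rho_real_def[abs_def] by (auto intro!: continuous_intros)
qed

lemma rho_real_upper: assumes "0 < r" shows "rho_real r \<le> 2 / r"
proof -
  have "integral {0..1} (\<lambda>x. x * trunc_mean (r * x)) \<le> integral {0..1} (\<lambda>x::real. 1 / r)"
  proof (rule integral_le)
    fix x :: real assume x: "x \<in> {0..1}"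
    have "0 \<le> bose (r * x)" using assms x by (simp add: bose_def)
    then have "r * x * trunc_mean (r * x) \<le> 1" by (simp add: trunc_mean_bose)
    then show "x * trunc_mean (r * x) \<le> 1 / r" using assms by (simp add: field_simps)
  qed (intro integrable_continuous_real continuous_rho_integrand continuous_on_const)+
  then show ?thesis by (simp add: rho_real_def)
qed

lemma rho_real_minus: "rho_real (- r) = 1 - rho_real r"
proof -
  have "integral {0..1} (\<lambda>x. x * trunc_mean (- r * x))
      = integral {0..1} (\<lambda>x. x - x * trunc_mean (r * x))"
    by (intro integral_cong) (simp add: trunc_mean_minus algebra_simps)
  also have "\<dots> = integral {0..1} (\<lambda>x::real. x) - integral {0..1} (\<lambda>x. x * trunc_mean (r * x))"
    by (intro integral_diff integrable_continuous_real continuous_rho_integrand continuous_intros)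
  also have "integral {0..1} (\<lambda>x::real. x) = 1 / 2"
    using ident_has_integral[of 0 "1::real"] by (simp add: integral_unique)
  finally show ?thesis by (simp add: rho_real_def)
qed

text \<open>By \<open>rho_real_upper\<close> the values tend to \<open>0\<close> at \<open>+\<infinity>\<close>, hence to \<open>1\<close> at \<open>-\<infinity>\<close> by \<open>rho_real_minus\<close>; the
intermediate value theorem and strict monotonicity do the rest.\<close>

lemma ex1_rho_real:
  assumes "0 < \<rho>" "\<rho> < 1" shows "\<exists>!r. rho_real r = \<rho>"
proof (rule ex_ex1I)
  define m where "m = min \<rho> (1 - \<rho>)"
  \<comment> \<open>Chosen so that the bound \<open>2 / s\<close> on \<open>rho_real s\<close> is at most \<open>\<rho>\<close> and at most \<open>1 - \<rho>\<close>.\<close>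
  define s where "s = 2 / m"
  have m: "0 < m" "m \<le> \<rho>" "m \<le> 1 - \<rho>" using assms by (auto simp: m_def)
  have s: "0 < s" "2 / s = m" using m by (auto simp: s_def)
  have "rho_real s \<le> \<rho>" "\<rho> \<le> rho_real (- s)"
    using rho_real_upper[OF s(1)] m s by (auto simp: rho_real_minus)
  moreover have "- s \<le> s" using s by simp
  ultimately show "\<exists>r. rho_real r = \<rho>"
    using IVT2'[of rho_real s \<rho> "- s"] continuous_on_subset[OF continuous_rho_real subset_UNIV] by blast
next
  fix r r' assume "rho_real r = \<rho>" "rho_real r' = \<rho>"
  then show "r = r'"
    using rho_real_strict_antimono[of r r'] rho_real_strict_antimono[of r' r] by linarith
qed

lemma nn_integral_rho:
  "(\<integral>\<^sup>+ x. ennreal (x * trunc_mean (r * x)) * indicator {0..1} x \<partial>lborel) = ennreal (rho_real r / 2)"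
proof -
  let ?f = "\<lambda>x. x * trunc_mean (r * x)"
  have s: "set_integrable lborel {0..1} ?f"
    by (rule borel_integrable_atLeastAtMost') (rule continuous_rho_integrand)
  have "(\<integral>\<^sup>+ x. ennreal (?f x) * indicator {0..1} x \<partial>lborel) = (\<integral>\<^sup>+ x. ennreal (indicator {0..1} x *\<^sub>R ?f x) \<partial>lborel)"
    by (intro nn_integral_cong) (auto split: split_indicator)
  also have "\<dots> = ennreal (LINT x:{0..1}|lborel. ?f x)"
    unfolding set_lebesgue_integral_def
    by (rule nn_integral_eq_integral) (use s trunc_mean_nonneg in \<open>auto simp: set_integrable_def split: split_indicator\<close>)
  also have "(LINT x:{0..1}|lborel. ?f x) = rho_real r / 2"
    using set_borel_integral_eq_integral(2)[OF s] by (simp add: rho_real_def)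
  finally show ?thesis .
qed

section \<open>The dilogarithm formula\<close>

lemma bose_antiderivative:
  obtains \<psi> where "\<psi> 0 = 0" "\<And>t. (\<psi> has_real_derivative bose t) (at t)"
proof -
  have "\<exists>F. \<forall>x::real. (-\<infinity>::ereal) < x \<longrightarrow> x < (\<infinity>::ereal) \<longrightarrow> (F has_vector_derivative bose x) (at x)"
    by (rule einterval_antiderivative) (auto intro: isCont_bose)
  then obtain F where F: "\<And>x. (F has_real_derivative bose x) (at x)"
    by (auto simp: has_real_derivative_iff_has_vector_derivative)
  show ?thesis
    by (rule that[of "\<lambda>t. F t - F 0"]) (auto intro!: derivative_eq_intros F)
qed

text \<open>Since \<open>x * trunc_mean (r * x) = 1 / r - bose (r * x) / r\<close>, an antiderivative is \<open>x / r - \<psi> (r * x) / r\<^sup>2\<close>.\<close>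

lemma rho_real_closed:
  assumes r: "r \<noteq> 0" and \<psi>: "\<psi> 0 = 0" "\<And>t. (\<psi> has_real_derivative bose t) (at t)"
  shows "r\<^sup>2 * rho_real r = 2 * r - 2 * \<psi> r"
proof -
  have "((\<lambda>x. x * trunc_mean (r * x)) has_integral (1 / r - \<psi> (r * 1) / r\<^sup>2) - (0 / r - \<psi> (r * 0) / r\<^sup>2)) {0..1}"
  proof (rule fundamental_theorem_of_calculus)
    fix x :: real
    have "bose (r * x) = 1 - r * x * trunc_mean (r * x)" using trunc_mean_bose[of "r * x"] by simp
    then have "1 / r - bose (r * x) * r / r\<^sup>2 = x * trunc_mean (r * x)"
      using r by (simp add: field_simps power2_eq_square)
    moreover have "((\<lambda>x. x / r - \<psi> (r * x) / r\<^sup>2) has_real_derivative 1 / r - bose (r * x) * r / r\<^sup>2) (at x)"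
      by (intro DERIV_diff DERIV_cdivide DERIV_ident DERIV_chain2[OF \<psi>(2)] DERIV_cmult_Id)
    ultimately show "((\<lambda>x. x / r - \<psi> (r * x) / r\<^sup>2) has_vector_derivative x * trunc_mean (r * x)) (at x within {0..1})"
      by (metis has_real_derivative_iff_has_vector_derivative has_vector_derivative_at_within)
  qed simp
  from integral_unique[OF this] show ?thesis
    using r \<psi> by (simp add: rho_real_def field_simps power2_eq_square)
qed

text \<open>The dilogarithm on \<open>[0,1]\<close>. The term with \<open>n = 0\<close> vanishes because \<open>1 / 0 = 0\<close>.\<close>

definition Li2 :: "real \<Rightarrow> real" where
  "Li2 u = (\<Sum>n. 1 / (real n)\<^sup>2 * u ^ n)"

lemma summable_Li2: "summable (\<lambda>n. 1 / (real n)\<^sup>2)"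
  using inverse_power_summable[of 2, where 'a=real] by (simp add: field_simps)

lemma Li2_0 [simp]: "Li2 0 = 0"
proof -
  have "(\<lambda>n. 1 / (real n)\<^sup>2 * 0 ^ n) = (\<lambda>n. 0)" by (auto simp: fun_eq_iff power_0_left)
  then show ?thesis by (simp add: Li2_def)
qed

lemma Li2_1: "Li2 1 = pi\<^sup>2 / 6"
proof -
  have "(\<lambda>n. 1 / (real (Suc n))\<^sup>2) sums (pi\<^sup>2 / 6)"
    using inverse_squares_sums by (simp add: add.commute)
  from sums_Suc[OF this] show ?thesis by (simp add: Li2_def sums_unique[symmetric])
qed

lemma continuous_Li2: "continuous_on {0..1} Li2"
proof -
  have "uniform_limit {0..1} (\<lambda>n u. \<Sum>i<n. 1 / (real i)\<^sup>2 * u ^ i) (\<lambda>u. \<Sum>i. 1 / (real i)\<^sup>2 * u ^ i) sequentially"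
  proof (rule Weierstrass_m_test[OF _ summable_Li2])
    fix n and u :: real assume "u \<in> {0..1}"
    then have "0 \<le> u ^ n" "u ^ n \<le> 1" by (auto simp: power_le_one)
    then show "norm (1 / (real n)\<^sup>2 * u ^ n) \<le> 1 / (real n)\<^sup>2"
      by (simp add: abs_mult divide_right_mono)
  qed
  then show ?thesis unfolding Li2_def[abs_def]
    by (rule uniform_limit_theorem[rotated]) (simp, intro always_eventually allI continuous_on_sum continuous_on_mult continuous_on_const continuous_on_power continuous_on_id)
qed

lemma DERIV_Li2:
  assumes u: "0 < u" "u < 1"
  shows "(Li2 has_real_derivative - (ln (1 - u) / u)) (at u)"
proof -
  have d: "(Li2 has_real_derivative (\<Sum>n. diffs (\<lambda>n. 1 / (real n)\<^sup>2) n * u ^ n)) (at u)"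
    unfolding Li2_def[abs_def]
    by (rule termdiffs_strong[of _ 1]) (use summable_Li2 u in auto)
  have df: "diffs (\<lambda>n. 1 / (real n)\<^sup>2) n = 1 / real (Suc n)" for n
    unfolding diffs_def by (simp add: power2_eq_square del: of_nat_Suc)
  have sm: "summable (\<lambda>n. 1 / real (Suc n) * u ^ n)"
  proof (rule summable_comparison_test_ev[OF _ summable_geometric[of u]])
    have "norm (1 / real (Suc n) * u ^ n) \<le> u ^ n" for n
      using u mult_right_mono[of "1 / real (Suc n)" 1 "u ^ n"] by (simp add: abs_mult)
    then show "\<forall>\<^sub>F n in sequentially. norm (1 / real (Suc n) * u ^ n) \<le> u ^ n"
      by (intro always_eventually allI)
  qed (use u in simp)
  have "ln (1 - u) = (\<Sum>n. (- 1) ^ n * (1 / real (n + 1)) * ((1 - u) - 1) ^ Suc n)"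
    using u by (intro ln_series) auto
  also have "\<dots> = (\<Sum>n. - u * (1 / real (Suc n) * u ^ n))"
  proof (intro suminf_cong)
    fix n
    have "(- 1) ^ n * (- u) ^ Suc n = - u * (u ^ n :: real)"
      using power_mult_distrib[of "- 1" "- u" n] by simp
    moreover have "(- 1) ^ n * (1 / real (n + 1)) * ((1 - u) - 1) ^ Suc n
       = (1 / real (Suc n)) * ((- 1) ^ n * (- u) ^ Suc n)"
      by simp
    ultimately show "(- 1) ^ n * (1 / real (n + 1)) * ((1 - u) - 1) ^ Suc n = - u * (1 / real (Suc n) * u ^ n)"
      by (metis mult.left_commute)
  qed
  also have "\<dots> = - u * (\<Sum>n. 1 / real (Suc n) * u ^ n)"
    using sm by (rule suminf_mult)
  finally have "(\<Sum>n. diffs (\<lambda>n. 1 / (real n)\<^sup>2) n * u ^ n) = - (ln (1 - u) / u)"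
    unfolding df using u by (simp add: field_simps)
  with d show ?thesis by simp
qed

context
  fixes \<psi> :: "real \<Rightarrow> real"
  assumes \<psi>: "\<psi> 0 = 0" "\<And>t. (\<psi> has_real_derivative bose t) (at t)"
begin

text \<open>The real part of the dilogarithm on all of \<open>(0,\<infinity>)\<close>. The two logarithmic terms and \<open>\<psi> (ln u)\<close> are found by
integrating \<open>- ln (1 - u) / u\<close> by parts with \<open>u = exp t\<close>; the constant \<open>\<pi>\<^sup>2 / 6\<close> is the value at \<open>u = 1\<close>.\<close>

definition Li2_ext :: "real \<Rightarrow> real" where
  "Li2_ext u = pi\<^sup>2 / 6 + (ln u)\<^sup>2 / 2 - ln u * ln \<bar>1 - u\<bar> + \<psi> (ln u)"

lemma DERIV_Li2_ext:
  assumes u: "0 < u" "u \<noteq> 1"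
  shows "(Li2_ext has_real_derivative - (ln \<bar>1 - u\<bar> / u)) (at u)"
proof -
  have l: "((\<lambda>u. ln \<bar>1 - u\<bar>) has_real_derivative - 1 / (1 - u)) (at u)"
  proof (cases "u < 1")
    case True
    have "((\<lambda>u. ln (1 - u)) has_real_derivative - 1 / (1 - u)) (at u)"
      using True by (auto intro!: derivative_eq_intros)
    then show ?thesis
      by (rule has_field_derivative_transform_within_open[of _ _ _ "{..<1}"]) (use True in auto)
  next
    case False
    have "((\<lambda>u. ln (u - 1)) has_real_derivative - 1 / (1 - u)) (at u)"
      using False u by (auto intro!: derivative_eq_intros simp: field_simps)
    then show ?thesis
      by (rule has_field_derivative_transform_within_open[of _ _ _ "{1<..}"]) (use False u in auto)
  qed
  have "((\<lambda>u. pi\<^sup>2 / 6 + (ln u)\<^sup>2 / 2) has_real_derivative ln u * (1/u)) (at u)"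
    using u by (auto intro!: derivative_eq_intros)
  moreover have "((\<lambda>u. ln u * ln \<bar>1 - u\<bar>) has_real_derivative (1/u) * ln \<bar>1 - u\<bar> + (- 1 / (1 - u)) * ln u) (at u)"
    using u by (intro DERIV_mult l DERIV_ln_divide)
  moreover have "((\<lambda>u. \<psi> (ln u)) has_real_derivative bose (ln u) * (1/u)) (at u)"
    using u by (intro DERIV_chain2[OF \<psi>(2)] DERIV_ln_divide)
  ultimately have "(Li2_ext has_real_derivative ln u * (1/u) - ((1/u) * ln \<bar>1 - u\<bar> + (- 1 / (1 - u)) * ln u) + bose (ln u) * (1/u)) (at u)"
    unfolding Li2_ext_def[abs_def] by (intro DERIV_add DERIV_diff)
  moreover have "bose (ln u) = ln u / (u - 1)" using u by (simp add: bose_def)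
  then have "ln u * (1/u) - ((1/u) * ln \<bar>1 - u\<bar> + (- 1 / (1 - u)) * ln u) + bose (ln u) * (1/u)
      = - (ln \<bar>1 - u\<bar> / u)"
    using u by (simp add: divide_simps) (simp add: algebra_simps)
  ultimately show ?thesis by metis
qed

text \<open>At \<open>u = 1\<close> the product \<open>ln u * ln \<bar>1 - u\<bar>\<close> tends to \<open>0\<close>, which is also its value since \<open>ln 1 = 0\<close>.\<close>

lemma isCont_Li2_ext:
  assumes u: "0 < u" shows "isCont Li2_ext u"
proof (cases "u = 1")
  case False
  then show ?thesis using DERIV_Li2_ext[OF u] DERIV_isCont by blast
next
  case True
  have a: "((\<lambda>u::real. ln u * ln \<bar>1 - u\<bar>) \<longlongrightarrow> 0) (at 1)"
  proof (rule filterlim_split_at)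
    have "((\<lambda>u::real. ln u * ln (1 - u)) \<longlongrightarrow> 0) (at_left 1)" by real_asymp
    then show "((\<lambda>u::real. ln u * ln \<bar>1 - u\<bar>) \<longlongrightarrow> 0) (at_left 1)"
      by (rule tendsto_cong[THEN iffD1, rotated]) (auto simp: eventually_at_filter)
    have "((\<lambda>u::real. ln u * ln (u - 1)) \<longlongrightarrow> 0) (at_right 1)" by real_asymp
    then show "((\<lambda>u::real. ln u * ln \<bar>1 - u\<bar>) \<longlongrightarrow> 0) (at_right 1)"
      by (rule tendsto_cong[THEN iffD1, rotated]) (auto simp: eventually_at_filter)
  qed
  have "isCont (\<lambda>u::real. ln u * ln \<bar>1 - u\<bar>) 1" using a by (simp add: isCont_def)
  moreover have "isCont (\<lambda>u. pi\<^sup>2 / 6 + (ln u)\<^sup>2 / 2) 1"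
    by (intro continuous_intros) auto
  moreover have "isCont (\<lambda>u. \<psi> (ln u)) 1"
    using isCont_o2[OF isCont_ln DERIV_isCont[OF \<psi>(2)], of 1] by simp
  ultimately show ?thesis unfolding True Li2_ext_def[abs_def]
    using isCont_add isCont_diff by blast
qed

text \<open>Both sides have the same derivative on \<open>(0,1)\<close>, are continuous on \<open>(0,1]\<close>, and agree at \<open>1\<close> by Euler's
evaluation of \<open>\<zeta>(2)\<close>. The comparison at \<open>1\<close> replaces a limit at \<open>0\<close>.\<close>

lemma Li2_ext_eq: assumes u: "0 < u" "u \<le> 1" shows "Li2_ext u = Li2 u"
proof (cases "u = 1")
  case False
  have "Li2_ext 1 - Li2 1 = Li2_ext u - Li2 u"
  proof (rule DERIV_isconst_end[of u 1 "\<lambda>u. Li2_ext u - Li2 u"])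
    show "u < 1" using u False by simp
    show "continuous_on {u..1} (\<lambda>u. Li2_ext u - Li2 u)"
      using u by (intro continuous_intros continuous_on_subset[OF continuous_Li2]
         continuous_at_imp_continuous_on ballI isCont_Li2_ext) auto
    fix x assume x: "u < x" "x < 1"
    then have "((\<lambda>u. Li2_ext u - Li2 u) has_real_derivative - (ln \<bar>1 - x\<bar> / x) - - (ln (1 - x) / x)) (at x)"
      using u by (intro DERIV_diff DERIV_Li2_ext DERIV_Li2) auto
    then show "((\<lambda>u. Li2_ext u - Li2 u) has_real_derivative 0) (at x)" using x by simp
  qed
  then show ?thesis by (simp add: Li2_1 Li2_ext_def[of 1] \<psi>)
qed (simp add: Li2_1 Li2_ext_def \<psi>)

text \<open>For \<open>u > 1\<close> the principal logarithm of \<open>1 - u\<close> has imaginary part \<open>\<pi>\<close>, which integrates against \<open>1 / u\<close> to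
\<open>\<pi> ln z\<close>. The singularity of the integrand at \<open>u = 1\<close> is harmless, because the antiderivative \<open>A\<close> is
continuous there.\<close>

lemma dilog_of_real:
  assumes z: "0 < z"
  shows "dilog (complex_of_real z) = complex_of_real (Li2_ext z) - \<i> * complex_of_real (if z \<le> 1 then 0 else pi * ln z)"
proof -
  define A where "A u = (if u \<le> 1 then complex_of_real (Li2 u)
     else complex_of_real (Li2_ext u) - \<i> * complex_of_real (pi * ln u))" for u
  have cA: "continuous_on ({0..1} \<union> {1..max 1 z}) A"
  proof -
    have 1: "continuous_on {1..max 1 z} (\<lambda>u. complex_of_real (Li2_ext u) - \<i> * complex_of_real (pi * ln u))"
      by (intro continuous_intros continuous_at_imp_continuous_on ballI isCont_Li2_ext) auto
    have 2: "continuous_on {0..1} (\<lambda>u. complex_of_real (Li2 u))"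
      by (intro continuous_intros continuous_Li2)
    show ?thesis unfolding A_def[abs_def]
      by (rule continuous_on_If[OF _ _ 2 1]) (auto simp: Li2_ext_eq)
  qed
  have "((\<lambda>u. - (Ln (1 - complex_of_real u) / complex_of_real u)) has_integral A z - A 0) {0..z}"
  proof (rule fundamental_theorem_of_calculus_interior_strong[of "{1}"])
    show "continuous_on {0..z} A" by (rule continuous_on_subset[OF cA]) auto
    fix u assume u: "u \<in> {0<..<z} - {1}"
    show "(A has_vector_derivative - (Ln (1 - complex_of_real u) / complex_of_real u)) (at u)"
    proof (cases "u < 1")
      case True
      have "((\<lambda>u. complex_of_real (Li2 u)) has_vector_derivative complex_of_real (- (ln (1 - u) / u))) (at u)"
        using True u by (intro has_vector_derivative_of_real DERIV_Li2) auto
      moreover have "complex_of_real (- (ln (1 - u) / u)) = - (Ln (1 - complex_of_real u) / complex_of_real u)"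
        using True Ln_of_real[of "1 - u"] by simp
      ultimately have "((\<lambda>u. complex_of_real (Li2 u)) has_vector_derivative - (Ln (1 - complex_of_real u) / complex_of_real u)) (at u)"
        by metis
      then show ?thesis
        by (rule has_vector_derivative_transform_within_open[of _ _ _ "{..<1}"]) (use True in \<open>auto simp: A_def\<close>)
    next
      case False
      then have u1: "1 < u" using u by simp
      have "((\<lambda>u. complex_of_real (Li2_ext u)) has_vector_derivative complex_of_real (- (ln \<bar>1 - u\<bar> / u))) (at u)"
        using u1 by (intro has_vector_derivative_of_real DERIV_Li2_ext) auto
      moreover have "((\<lambda>u. complex_of_real (pi * ln u)) has_vector_derivative complex_of_real (pi / u)) (at u)"
        using u1 by (intro has_vector_derivative_of_real)
          (auto intro!: derivative_eq_intros)
      ultimately have "((\<lambda>u. complex_of_real (Li2_ext u) - \<i> * complex_of_real (pi * ln u)) has_vector_derivative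
          complex_of_real (- (ln \<bar>1 - u\<bar> / u)) - \<i> * complex_of_real (pi / u)) (at u)"
        by (intro has_vector_derivative_diff has_vector_derivative_mult_right)
      moreover have "complex_of_real (- (ln \<bar>1 - u\<bar> / u)) - \<i> * complex_of_real (pi / u)
         = - (Ln (1 - complex_of_real u) / complex_of_real u)"
      proof -
        have "Ln (1 - complex_of_real u) = Ln (- complex_of_real (u - 1))" by simp
        also have "\<dots> = complex_of_real (ln (u - 1)) + \<i> * pi"
          using u1 Ln_minus[of "complex_of_real (u - 1)"] by (simp add: Ln_of_real flip: of_real_diff)
        finally show ?thesis using u1 by (simp add: add_divide_distrib)
      qed
      ultimately have "((\<lambda>u. complex_of_real (Li2_ext u) - \<i> * complex_of_real (pi * ln u)) has_vector_derivative
         - (Ln (1 - complex_of_real u) / complex_of_real u)) (at u)" by simp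
      then show ?thesis
        by (rule has_vector_derivative_transform_within_open[of _ _ _ "{1<..}"]) (use u1 in \<open>auto simp: A_def\<close>)
    qed
  qed (use z in auto)
  from has_integral_neg[OF this]
  have "integral {0..z} (\<lambda>u. Ln (1 - complex_of_real u) / complex_of_real u) = - (A z - A 0)"
    by (intro integral_unique) simp
  moreover have "dilog (complex_of_real z) = - integral {0..z} (\<lambda>u. Ln (1 - complex_of_real u) / complex_of_real u)"
    unfolding dilog_def by (subst contour_integral_linepath_Reals_eq) (use z in auto)
  ultimately have "dilog (complex_of_real z) = A z - A 0" by simp
  then show ?thesis using z by (simp add: A_def Li2_ext_eq)
qed

end

text \<open>For \<open>r > 0\<close> the imaginary parts of \<open>- 2 r Ln (1 - exp r)\<close> and \<open>- 2 dilog (exp r)\<close> are \<open>- 2 \<pi> r\<close> and \<open>2 \<pi> r\<close>.\<close>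

lemma rho_param_eq: "rho_param r = complex_of_real (rho_real r)"
proof (cases "r = 0")
  case True
  have "integral {0..1} (\<lambda>x::real. x * (1/2)) = 1/2 * (1/2)"
    using ident_has_integral[of 0 "1::real"] by (simp add: integral_unique)
  then show ?thesis using True by (simp add: rho_param_def rho_real_def trunc_mean_def)
next
  case False
  obtain \<psi> where \<psi>: "\<psi> 0 = 0" "\<And>t. (\<psi> has_real_derivative bose t) (at t)"
    using bose_antiderivative by blast
  have e: "exp (complex_of_real r) = complex_of_real (exp r)" by (simp add: exp_of_real)
  define P where "P = Li2_ext \<psi> (exp r)"
  define w where "w = ln \<bar>1 - exp r\<bar>"
  have P: "2 * P = pi\<^sup>2 / 3 + r\<^sup>2 - 2 * r * w + 2 * \<psi> r"
    by (simp add: P_def w_def Li2_ext_def[OF \<psi>] field_simps)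
  have cc: "r\<^sup>2 * rho_real r = r * (r - 2 * w + 2) - 2 * P + pi\<^sup>2 / 3"
    unfolding P rho_real_closed[OF False \<psi>] by (simp add: algebra_simps power2_eq_square)
  have key: "of_real r * (of_real r - 2 * Ln (1 - exp (of_real r)) + 2) - 2 * dilog (exp (of_real r))
     = of_real (r * (r - 2 * w + 2) - 2 * P)"
  proof (cases "r < 0")
    case True
    have "Ln (1 - complex_of_real (exp r)) = of_real w"
      using True Ln_of_real[of "1 - exp r"] by (simp add: w_def)
    then show ?thesis
      unfolding e dilog_of_real[OF \<psi> exp_gt_zero] P_def[symmetric] using True by simp
  next
    case F2: False
    then have r0: "0 < r" using False by simp
    have "Ln (1 - complex_of_real (exp r)) = Ln (- complex_of_real (exp r - 1))" by simp
    also have "\<dots> = complex_of_real w + \<i> * pi"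
      using r0 Ln_minus[of "complex_of_real (exp r - 1)"] by (simp add: Ln_of_real w_def flip: of_real_diff)
    finally show ?thesis
      unfolding e dilog_of_real[OF \<psi> exp_gt_zero] P_def[symmetric] using r0 by (simp add: algebra_simps)
  qed
  have "rho_param r = complex_of_real ((r * (r - 2 * w + 2) - 2 * P + pi\<^sup>2 / 3) / r\<^sup>2)"
    using False unfolding rho_param_def Let_def key by (simp add: add_divide_distrib)
  also have "\<dots> = complex_of_real (rho_real r)"
    using False unfolding cc[symmetric] by simp
  finally show ?thesis .
qed

section \<open>Primitives of exponential functions\<close>

text \<open>The integral of \<open>exp (- r t)\<close> over \<open>[0,s]\<close>, in a form that covers \<open>r = 0\<close> as well.\<close>

definition E :: "real \<Rightarrow> real \<Rightarrow> real" where
  "E r s = (if r = 0 then s else (1 - exp (- r * s)) / r)"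

lemma E_0 [simp]: "E r 0 = 0"
  by (simp add: E_def)

lemma DERIV_E: "(E r has_real_derivative exp (- r * s)) (at s)"
proof (cases "r = 0")
  case True
  then have "E r = (\<lambda>s. s)" by (auto simp: E_def)
  then show ?thesis using True by simp
next
  case False
  then have "E r = (\<lambda>s. (1 - exp (- r * s)) / r)" by (auto simp: E_def)
  then show ?thesis using False by (auto intro!: derivative_eq_intros)
qed

lemma continuous_on_E: "continuous_on S (E r)"
  using DERIV_E by (meson DERIV_continuous continuous_at_imp_continuous_on)

lemma borel_measurable_E [measurable]: "E r \<in> borel_measurable borel"
  by (rule borel_measurable_continuous_onI[OF continuous_on_E])

lemma E_strict_mono: "a < b \<Longrightarrow> E r a < E r b"
  by (rule DERIV_pos_imp_increasing[of a b "E r"]) (use DERIV_E exp_gt_zero in blast)+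

lemma E_pos: "0 < s \<Longrightarrow> 0 < E r s"
  using E_strict_mono[of 0 s r] by simp

lemma E_inj: "E r a = E r b \<Longrightarrow> a = b"
  using E_strict_mono[of a b r] E_strict_mono[of b a r] by (cases a b rule: linorder_cases) auto

text \<open>Substituting \<open>t \<rightarrow> s - t\<close> in the integral exchanges \<open>r\<close> and \<open>- r\<close> up to the factor \<open>exp (- r * s)\<close>.\<close>

lemma E_flip: "exp (- r * s) * E (- r) s = E r s"
  by (cases "r = 0") (auto simp: E_def field_simps simp flip: exp_add)

lemma exp_E: "exp (- r * s) = 1 - r * E r s"
  by (simp add: E_def)

lemma nn_integral_exp_E:
  assumes "0 \<le> b"
  shows "(\<integral>\<^sup>+ s. ennreal (exp (- r * s)) * indicator {0..b} s \<partial>lborel) = ennreal (E r b)"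
  using nn_integral_FTC_Icc_interior[of "\<lambda>s. exp (- r * s)" 0 b "E r"] assms DERIV_E continuous_on_E by simp

lemma E_nonzero: "0 < s \<Longrightarrow> E r s \<noteq> 0"
  using E_pos[of s r] by simp

lemma E_nonneg: "0 \<le> s \<Longrightarrow> 0 \<le> E r s"
  using E_pos[of s r] by (cases "s = 0") auto

lemma E_1_pos [simp]: "0 < E r 1"
  by (rule E_pos) simp

lemma E_1_nonneg [simp]: "0 \<le> E r 1"
  using E_1_pos[of r] by linarith

lemma E_1_nonzero [simp]: "E r 1 \<noteq> 0"
  using E_1_pos[of r] by linarith

lemma nn_integral_exp_quot:
  assumes "0 < x" "0 \<le> b"
  shows "(\<integral>\<^sup>+ s. ennreal (1 * exp (- r * s) / E r x) * indicator {0..b} s \<partial>lborel) = ennreal (E r b / E r x)"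
proof -
  have "(\<integral>\<^sup>+ s. ennreal (1 * exp (- r * s) / E r x) * indicator {0..b} s \<partial>lborel)
     = (\<integral>\<^sup>+ s. ennreal (1 / E r x) * (ennreal (exp (- r * s)) * indicator {0..b} s) \<partial>lborel)"
    using E_pos[OF assms(1), of r] by (intro nn_integral_cong) (simp add: mult.assoc[symmetric] flip: ennreal_mult)
  also have "\<dots> = ennreal (1 / E r x) * ennreal (E r b)"
    unfolding nn_integral_exp_E[OF assms(2), symmetric] by (rule nn_integral_cmult) measurable
  also have "\<dots> = ennreal (E r b / E r x)"
  proof -
    have "0 \<le> E r b" using E_pos[of b r] assms(2) by (cases "b = 0") auto
    then show ?thesis using E_pos[OF assms(1), of r] by (subst ennreal_mult[symmetric]) auto
  qed
  finally show ?thesis .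
qed

text \<open>By the mean value theorem \<open>E r x = x exp (- r z)\<close> with \<open>0 < z < x\<close>, so \<open>ln (E r x)\<close> differs from the integrable
function \<open>ln x\<close> by at most \<open>\<bar>r\<bar>\<close>.\<close>

lemma integrable_ln_E: "set_integrable lborel {0..1} (\<lambda>x. ln (E r x))"
proof -
  have bd: "\<bar>ln (E r x)\<bar> \<le> - ln x + \<bar>r\<bar>" if x: "0 < x" "x \<le> 1" for x
  proof -
    obtain z where z: "0 < z" "z < x" "E r x - E r 0 = (x - 0) * exp (- r * z)"
      using MVT2[of 0 x "E r" "\<lambda>s. exp (- r * s)"] x DERIV_E by blast
    then have "ln (E r x) = ln x - r * z" using x by (simp add: ln_mult)
    moreover have "\<bar>r * z\<bar> \<le> \<bar>r\<bar> * 1" unfolding abs_mult using z x by (intro mult_left_mono) auto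
    moreover have "ln x \<le> 0" using x by simp
    ultimately show ?thesis by linarith
  qed
  have il: "integrable lborel (\<lambda>s. (- ln s + \<bar>r\<bar>) * indicator {0..1} s)"
  proof -
    have "integrable lborel (\<lambda>s::real. - ln s * indicator {0..1} s)"
    proof (rule integrable_of_nn_integral)
      have "(\<integral>\<^sup>+ s. ennreal (- ln s * indicator {0..1} s) \<partial>lborel) = (\<integral>\<^sup>+ s. ennreal (- ln s) * indicator {0..1} s \<partial>lborel)"
        by (intro nn_integral_cong) (auto split: split_indicator)
      then show "(\<integral>\<^sup>+ s. ennreal (- ln s * indicator {0..1} s) \<partial>lborel) < \<infinity>"
        by (simp add: nn_integral_neg_ln)
      fix s :: real show "0 \<le> - ln s * indicator {0..1} s"
        by (cases "s = 0") (auto split: split_indicator)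
    qed auto
    moreover have "integrable lborel (\<lambda>s::real. \<bar>r\<bar> * indicator {0..1} s)" by simp
    ultimately have "integrable lborel (\<lambda>s::real. - ln s * indicator {0..1} s + \<bar>r\<bar> * indicator {0..1} s)"
      by (rule Bochner_Integration.integrable_add)
    then show ?thesis by (simp add: algebra_simps)
  qed
  show ?thesis unfolding set_integrable_def
    by (rule Bochner_Integration.integrable_bound[OF il], simp,
        rule AE_mp[OF AE_lborel_singleton[of 0]]) (auto intro!: AE_I2 bd order_trans[OF bd] split: split_indicator)
qed

lemma nn_integral_mean_E:
  assumes x: "0 < x"
  shows "(\<integral>\<^sup>+ s. ennreal (s * exp (- r * s) / E r x) * indicator {0..x} s \<partial>lborel) = ennreal (x * trunc_mean (r * x))"
proof (cases "r = 0")
  case True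
  have "(\<integral>\<^sup>+ s. ennreal (s * exp (- r * s) / E r x) * indicator {0..x} s \<partial>lborel) = ennreal (x\<^sup>2 / (2 * x) - 0\<^sup>2 / (2 * x))"
  proof (rule nn_integral_FTC_Icc_interior)
    fix s show "((\<lambda>s. s\<^sup>2 / (2 * x)) has_real_derivative s * exp (- r * s) / E r x) (at s)"
      using x True by (auto intro!: derivative_eq_intros simp: E_def)
  qed (use x in \<open>auto intro!: continuous_intros simp: True E_def\<close>)
  then show ?thesis using x by (simp add: True trunc_mean_def power2_eq_square)
next
  case False
  let ?F = "\<lambda>s. (1 - exp (- r * s) * (1 + r * s)) / r\<^sup>2 / E r x"
  have E0: "0 < E r x" using E_pos[OF x] .
  have "(\<integral>\<^sup>+ s. ennreal (s * exp (- r * s) / E r x) * indicator {0..x} s \<partial>lborel) = ennreal (?F x - ?F 0)"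
  proof (rule nn_integral_FTC_Icc_interior)
    fix s
    have "((\<lambda>s. 1 - exp (- r * s) * (1 + r * s)) has_real_derivative (s * exp (- r * s)) * r\<^sup>2) (at s)"
      by (auto intro!: derivative_eq_intros simp: algebra_simps power2_eq_square)
    from DERIV_cdivide[OF DERIV_cdivide[OF this, of "r\<^sup>2"], of "E r x"]
    show "(?F has_real_derivative s * exp (- r * s) / E r x) (at s)"
      using False by simp
  qed (use x E0 False in \<open>auto intro!: continuous_intros\<close>)
  also have "?F x - ?F 0 = x * trunc_mean (r * x)"
  proof -
    define e where "e = exp (r * x)"
    have e: "e \<noteq> 1" "0 < e" "exp (- r * x) = 1 / e" using x False by (auto simp: e_def exp_minus field_simps)
    have "?F x = (1 - (1/e) * (1 + r * x)) / (r * (1 - 1/e))"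
      using False e by (simp add: E_def power2_eq_square)
    also have "\<dots> = (e - 1 - r * x) / (r * (e - 1))"
      using False e by (simp add: field_simps)
    also have "\<dots> = x * trunc_mean (r * x)"
      using False e x by (simp add: trunc_mean_def e_def[symmetric] field_simps)
    finally show ?thesis by simp
  qed
  finally show ?thesis .
qed

section \<open>The entropy bound for a permuton density\<close>

text \<open>The part of the entropy bound that does not depend on the permuton; the summand \<open>1\<close> is \<open>- \<integral>\<^sub>0\<^sup>1 ln\<close>.\<close>

definition entropy_const :: "real \<Rightarrow> real" where
  "entropy_const r = 1 + (LINT x:{0..1}|lborel. ln (E r x))"

text \<open>Densities whose marginals are uniform at every point and not just almost everywhere. Each permuton density
has such a version (lemma \<open>permuton_copula_density\<close> below). Then all sections are honest densities, and
exceptional null sets need not be carried through the computations.\<close>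

locale copula_density =
  fixes g :: "real \<times> real \<Rightarrow> real"
  assumes meas [measurable]: "g \<in> borel_measurable (borel \<Otimes>\<^sub>M borel)"
    and nonneg: "\<And>p. 0 \<le> g p"
    and row: "\<And>x. (\<integral>\<^sup>+ y. ennreal (g (x, y)) \<partial>lborel) = indicator {0..1} x"
    and col: "\<And>y. (\<integral>\<^sup>+ x. ennreal (g (x, y)) \<partial>lborel) = indicator {0..1} y"
    and outside: "\<And>p. p \<notin> unit_square \<Longrightarrow> g p = 0"
begin

abbreviation P :: "(real \<times> real) measure" where "P \<equiv> lborel \<Otimes>\<^sub>M lborel"

text \<open>\<open>G\<close> is the distribution function, and \<open>U\<close> and \<open>V\<close> are its partial derivatives in \<open>y\<close> and in \<open>x\<close>.\<close>

definition U :: "real \<Rightarrow> real \<Rightarrow> real" where "U x y = cumul (\<lambda>t. g (t, y)) x"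
definition V :: "real \<Rightarrow> real \<Rightarrow> real" where "V x y = cumul (\<lambda>v. g (x, v)) y"
definition G :: "real \<Rightarrow> real \<Rightarrow> real" where "G x y = cumul (U x) y"

lemma measurable_U [measurable]:
  assumes [measurable]: "f \<in> borel_measurable N" "h \<in> borel_measurable N"
  shows "(\<lambda>p. U (f p) (h p)) \<in> borel_measurable N"
  unfolding U_def by measurable

lemma measurable_V [measurable]:
  assumes [measurable]: "f \<in> borel_measurable N" "h \<in> borel_measurable N"
  shows "(\<lambda>p. V (f p) (h p)) \<in> borel_measurable N"
  unfolding V_def by measurable

lemma measurable_G [measurable]:
  assumes [measurable]: "f \<in> borel_measurable N" "h \<in> borel_measurable N"
  shows "(\<lambda>p. G (f p) (h p)) \<in> borel_measurable N"
  unfolding G_def by measurable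

lemma row_fin: "(\<integral>\<^sup>+ y. ennreal (g (x, y)) \<partial>lborel) < \<infinity>"
  unfolding row by (simp add: indicator_def)

lemma col_fin: "(\<integral>\<^sup>+ x. ennreal (g (x, y)) \<partial>lborel) < \<infinity>"
  unfolding col by (simp add: indicator_def)

lemma ennreal_U: "ennreal (U x y) = (\<integral>\<^sup>+ t. ennreal (g (t, y)) * indicator {..x} t \<partial>lborel)"
  unfolding U_def by (rule cumul_emeasure[OF _ col_fin]) measurable

lemma ennreal_V: "ennreal (V x y) = (\<integral>\<^sup>+ v. ennreal (g (x, v)) * indicator {..y} v \<partial>lborel)"
  unfolding V_def by (rule cumul_emeasure[OF _ row_fin]) measurable

lemma U_nonneg [simp]: "0 \<le> U x y" and V_nonneg [simp]: "0 \<le> V x y" and G_nonneg [simp]: "0 \<le> G x y"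
  by (simp_all add: U_def V_def G_def)

lemma U_full: "1 \<le> x \<Longrightarrow> ennreal (U x y) = indicator {0..1} y"
proof -
  assume x: "1 \<le> x"
  have "ennreal (g (t, y)) * indicator {..x} t = ennreal (g (t, y))" for t
    using outside[of "(t, y)"] x by (auto split: split_indicator)
  then show ?thesis by (simp add: ennreal_U col)
qed

lemma U_le: "ennreal (U x y) \<le> indicator {0..1} y"
  unfolding ennreal_U col[symmetric] by (intro nn_integral_mono) (auto split: split_indicator)

lemma U_le_1: "U x y \<le> 1"
  using order_trans[OF U_le[of x y], of 1] by (simp add: indicator_def)

lemma U_zero: "y \<notin> {0..1} \<Longrightarrow> U x y = 0"
  using U_le[of x y] U_nonneg[of x y] by (simp add: ennreal_eq_0_iff del: atLeastAtMost_iff)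

lemma V_le: "ennreal (V x y) \<le> indicator {0..1} x"
  unfolding ennreal_V row[symmetric] by (intro nn_integral_mono) (auto split: split_indicator)

lemma nn_V: "(\<integral>\<^sup>+ t. ennreal (V t y) \<partial>lborel) < \<infinity>"
proof -
  have "(\<integral>\<^sup>+ t. ennreal (V t y) \<partial>lborel) \<le> (\<integral>\<^sup>+ t. indicator {0..1} t \<partial>(lborel::real measure))"
    by (intro nn_integral_mono V_le)
  then show ?thesis by (simp add: le_less_trans)
qed

lemma nn_U_le: "(\<integral>\<^sup>+ v. ennreal (U x v) \<partial>lborel) \<le> 1"
proof -
  have "(\<integral>\<^sup>+ v. ennreal (U x v) \<partial>lborel) \<le> (\<integral>\<^sup>+ t. indicator {0..1} t \<partial>(lborel::real measure))"
    by (intro nn_integral_mono U_le)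
  then show ?thesis by simp
qed

lemma nn_U_fin: "(\<integral>\<^sup>+ v. ennreal (U x v) \<partial>lborel) < \<infinity>"
  using nn_U_le[of x] by (simp add: le_less_trans)

lemma ennreal_G: "ennreal (G x y) = (\<integral>\<^sup>+ v. ennreal (U x v) * indicator {..y} v \<partial>lborel)"
  unfolding G_def by (rule cumul_emeasure[OF _ nn_U_fin]) measurable

lemma ennreal_G_prod:
  "ennreal (G x y) = (\<integral>\<^sup>+ v. (\<integral>\<^sup>+ t. ennreal (g (t, v)) * (if t \<le> x \<and> v \<le> y then 1 else 0) \<partial>lborel) \<partial>lborel)"
  unfolding ennreal_G ennreal_U
proof (intro nn_integral_cong)
  fix v
  have "(\<integral>\<^sup>+ t. ennreal (g (t, v)) * indicator {..x} t \<partial>lborel) * indicator {..y} v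
      = (\<integral>\<^sup>+ t. ennreal (g (t, v)) * indicator {..x} t * indicator {..y} v \<partial>lborel)"
    by (rule nn_integral_multc[symmetric]) measurable
  also have "\<dots> = (\<integral>\<^sup>+ t. ennreal (g (t, v)) * (if t \<le> x \<and> v \<le> y then 1 else 0) \<partial>lborel)"
    by (intro nn_integral_cong) (auto split: split_indicator)
  finally show "(\<integral>\<^sup>+ t. ennreal (g (t, v)) * indicator {..x} t \<partial>lborel) * indicator {..y} v
     = (\<integral>\<^sup>+ t. ennreal (g (t, v)) * (if t \<le> x \<and> v \<le> y then 1 else 0) \<partial>lborel)" .
qed

lemma nn_swap:
  assumes [measurable]: "f \<in> borel_measurable (borel \<Otimes>\<^sub>M borel)"
  shows "(\<integral>\<^sup>+ v. (\<integral>\<^sup>+ t. f (t, v) \<partial>lborel) \<partial>lborel) = (\<integral>\<^sup>+ t. (\<integral>\<^sup>+ v. f (t, v) \<partial>lborel) \<partial>(lborel :: real measure))"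
  by (rule lborel_pair.Fubini') simp

lemma ennreal_G_V: "ennreal (G x y) = (\<integral>\<^sup>+ t. ennreal (V t y) * indicator {..x} t \<partial>lborel)"
proof -
  have "ennreal (G x y) = (\<integral>\<^sup>+ t. (\<integral>\<^sup>+ v. ennreal (g (t, v)) * (if t \<le> x \<and> v \<le> y then 1 else 0) \<partial>lborel) \<partial>lborel)"
    unfolding ennreal_G_prod by (rule nn_swap[where f="\<lambda>(t,v). ennreal (g (t, v)) * (if t \<le> x \<and> v \<le> y then 1 else 0)", simplified]) measurable
  also have "\<dots> = (\<integral>\<^sup>+ t. ennreal (V t y) * indicator {..x} t \<partial>lborel)"
    unfolding ennreal_V
  proof (intro nn_integral_cong)
    fix t
    have "(\<integral>\<^sup>+ v. ennreal (g (t, v)) * indicator {..y} v \<partial>lborel) * indicator {..x} t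
        = (\<integral>\<^sup>+ v. ennreal (g (t, v)) * indicator {..y} v * indicator {..x} t \<partial>lborel)"
      by (rule nn_integral_multc[symmetric]) measurable
    also have "\<dots> = (\<integral>\<^sup>+ v. ennreal (g (t, v)) * (if t \<le> x \<and> v \<le> y then 1 else 0) \<partial>lborel)"
      by (intro nn_integral_cong) (auto split: split_indicator)
    finally show "(\<integral>\<^sup>+ v. ennreal (g (t, v)) * (if t \<le> x \<and> v \<le> y then 1 else 0) \<partial>lborel)
       = (\<integral>\<^sup>+ v. ennreal (g (t, v)) * indicator {..y} v \<partial>lborel) * indicator {..x} t" by simp
  qed
  finally show ?thesis .
qed

lemma G_eq_cumul_V: "G x y = cumul (\<lambda>t. V t y) x"
  unfolding cumul_def ennreal_G_V[symmetric] by simp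

lemma V_full: "1 \<le> y \<Longrightarrow> ennreal (V t y) = indicator {0..1} t"
proof -
  assume y: "1 \<le> y"
  have "ennreal (g (t, v)) * indicator {..y} v = ennreal (g (t, v))" for v
    using outside[of "(t, v)"] y by (auto split: split_indicator)
  then show ?thesis by (simp add: ennreal_V row)
qed

lemma G_top: assumes "0 \<le> x" "x \<le> 1" shows "G x 1 = x"
proof -
  have "ennreal (G x 1) = (\<integral>\<^sup>+ t. indicator {0..x} t \<partial>lborel)"
    unfolding ennreal_G_V using assms by (intro nn_integral_cong) (auto simp: V_full split: split_indicator)
  then show ?thesis using assms by simp
qed

lemma G_right: assumes "0 \<le> y" "y \<le> 1" shows "G 1 y = y"
proof -
  have "ennreal (G 1 y) = (\<integral>\<^sup>+ t. indicator {0..y} t \<partial>lborel)"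
    unfolding ennreal_G using assms by (intro nn_integral_cong) (auto simp: U_full split: split_indicator)
  then show ?thesis using assms by simp
qed

lemma G_le_1: "G x y \<le> 1"
proof -
  have "ennreal (G x y) \<le> (\<integral>\<^sup>+ v. ennreal (U x v) \<partial>lborel)"
    unfolding ennreal_G by (intro nn_integral_mono) (auto split: split_indicator)
  also note nn_U_le
  finally show ?thesis by simp
qed

lemma nn_integral_U_G:
  assumes [measurable]: "f \<in> borel_measurable borel"
  shows "(\<integral>\<^sup>+ v. ennreal (U x v) * f (G x v) * indicator {..b} v \<partial>lborel) = (\<integral>\<^sup>+ s. f s * indicator {0..G x b} s \<partial>lborel)"
  unfolding G_def by (rule nn_integral_cumul[OF _ nn_U_fin assms]) measurable

text \<open>Substitution \<open>s = U t y\<close> along a horizontal line. With \<open>f = - ln\<close> this yields the integral of \<open>g ln U\<close>, and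
with the indicator of \<open>{0}\<close> it shows that \<open>U\<close> vanishes only on a \<open>g\<close>-null set.\<close>

lemma nn_integral_g_U:
  assumes [measurable]: "f \<in> borel_measurable borel"
  shows "(\<integral>\<^sup>+ t. ennreal (g (t, y)) * f (U t y) \<partial>lborel) = (\<integral>\<^sup>+ s. f s * indicator {0..1} s \<partial>lborel) * indicator {0..1} y"
proof (cases "y \<in> {0..1}")
  case True
  have U1: "U 1 y = 1" using U_full[of 1 y] True by (simp add: ennreal_eq_1)
  have "(\<integral>\<^sup>+ t. ennreal (g (t, y)) * f (U t y) \<partial>lborel) = (\<integral>\<^sup>+ t. ennreal (g (t, y)) * f (U t y) * indicator {..1} t \<partial>lborel)"
    using outside by (intro nn_integral_cong) (auto split: split_indicator)
  also have "\<dots> = (\<integral>\<^sup>+ s. f s * indicator {0..U 1 y} s \<partial>lborel)"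
    unfolding U_def by (rule nn_integral_cumul[OF _ col_fin assms]) measurable
  finally show ?thesis using True by (simp add: U1)
next
  case False
  then show ?thesis using outside by simp
qed

lemma nn_P: "f \<in> borel_measurable (borel \<Otimes>\<^sub>M borel) \<Longrightarrow> (\<integral>\<^sup>+ p. f p \<partial>P) = (\<integral>\<^sup>+ x. \<integral>\<^sup>+ y. f (x, y) \<partial>lborel \<partial>lborel)"
  by (rule lborel.nn_integral_fst[symmetric]) simp

lemma nn_P': "f \<in> borel_measurable (borel \<Otimes>\<^sub>M borel) \<Longrightarrow> (\<integral>\<^sup>+ p. f p \<partial>P) = (\<integral>\<^sup>+ y. \<integral>\<^sup>+ x. f (x, y) \<partial>lborel \<partial>lborel)"
  by (rule lborel_pair.nn_integral_snd[symmetric]) simp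

lemma nn_g: "(\<integral>\<^sup>+ p. ennreal (g p) \<partial>P) = 1"
  by (subst nn_P) (auto simp: row)

text \<open>The density against which \<open>g\<close> is compared. For fixed \<open>x\<close> and with \<open>s = G x y\<close>, it gives \<open>s\<close> the truncated
exponential law on \<open>[0,x]\<close> of parameter \<open>r\<close>.\<close>

definition h :: "real \<Rightarrow> real \<times> real \<Rightarrow> real" where
  "h r = (\<lambda>(x, y). if 0 < x \<and> x \<le> 1 then U x y * exp (- r * G x y) / E r x else 0)"

lemma measurable_h [measurable]: "h r \<in> borel_measurable (borel \<Otimes>\<^sub>M borel)"
  unfolding h_def by measurable

lemma h_nonneg: "0 \<le> h r p"
  using E_pos[of _ r] by (auto simp: h_def intro!: divide_nonneg_pos split: prod.split)

lemma nn_integral_h_G: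
  assumes [measurable]: "f \<in> borel_measurable borel" and f0: "\<And>s. 0 \<le> f s" and x: "0 < x" "x \<le> 1"
  shows "(\<integral>\<^sup>+ v. ennreal (h r (x, v) * f (G x v)) * indicator {..y} v \<partial>lborel)
     = (\<integral>\<^sup>+ s. ennreal (f s * exp (- r * s) / E r x) * indicator {0..G x y} s \<partial>lborel)"
proof -
  have "ennreal (h r (x, v) * f (G x v)) * indicator {..y} v =
     ennreal (U x v) * ennreal (f (G x v) * exp (- r * G x v) / E r x) * indicator {..y} v" for v
    using x f0 E_pos[of x r] by (simp add: h_def field_simps flip: ennreal_mult)
  then show ?thesis
    using nn_integral_U_G[of "\<lambda>s. ennreal (f s * exp (- r * s) / E r x)" x y] by simp
qed

lemma nn_integral_h_G_full:
  assumes f [measurable]: "f \<in> borel_measurable borel" and f0: "\<And>s. 0 \<le> f s" and x: "0 < x" "x \<le> 1"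
  shows "(\<integral>\<^sup>+ v. ennreal (h r (x, v) * f (G x v)) \<partial>lborel)
     = (\<integral>\<^sup>+ s. ennreal (f s * exp (- r * s) / E r x) * indicator {0..x} s \<partial>lborel)"
proof -
  have "(\<integral>\<^sup>+ v. ennreal (h r (x, v) * f (G x v)) \<partial>lborel) = (\<integral>\<^sup>+ v. ennreal (h r (x, v) * f (G x v)) * indicator {..1} v \<partial>lborel)"
    using U_zero by (intro nn_integral_cong) (auto simp: h_def split: split_indicator)
  then show ?thesis using nn_integral_h_G[OF f f0 x, of r 1] G_top x by simp
qed

lemma nn_h: "(\<integral>\<^sup>+ p. ennreal (h r p) \<partial>P) = 1"
proof -
  have "(\<integral>\<^sup>+ v. ennreal (h r (x, v)) \<partial>lborel) = indicator {0<..1} x" for x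
  proof (cases "0 < x \<and> x \<le> 1")
    case True
    then show ?thesis
      using nn_integral_h_G_full[of "\<lambda>_. 1" x r] nn_integral_exp_quot[of x x r] E_pos[of x r] by simp
  qed (auto simp: h_def)
  then show ?thesis by (subst nn_P) (auto)
qed

lemma AE_g_h_pos: "AE p in P. 0 < g p \<longrightarrow> 0 < h r p"
proof -
  have "(\<integral>\<^sup>+ p. ennreal (g p) * indicator {0} (U (fst p) (snd p)) \<partial>P)
     = (\<integral>\<^sup>+ y. \<integral>\<^sup>+ x. ennreal (g (x, y)) * indicator {0} (U x y) \<partial>lborel \<partial>lborel)"
    by (subst nn_P') simp_all
  also have "\<dots> = (\<integral>\<^sup>+ y. (\<integral>\<^sup>+ s. indicator {0} s * indicator {0..1} s \<partial>(lborel :: real measure)) * indicator {0..1} y \<partial>(lborel :: real measure))"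
    by (intro nn_integral_cong nn_integral_g_U[of "indicator {0}"]) simp
  also have "(\<integral>\<^sup>+ s. indicator {0} s * indicator {0..1} s \<partial>(lborel :: real measure)) = 0"
    by (subst nn_integral_0_iff_AE, measurable, use AE_lborel_singleton[of 0] in eventually_elim) auto
  finally have z: "(\<integral>\<^sup>+ p. ennreal (g p) * indicator {0} (U (fst p) (snd p)) \<partial>P) = 0" by simp
  have 1: "AE p in P. ennreal (g p) * indicator {0} (U (fst p) (snd p)) = 0"
    by (rule nn_integral_0_iff_AE[THEN iffD1, OF _ z]) measurable
  have "(\<integral>\<^sup>+ p. ennreal (g p) * indicator {0} (fst p) \<partial>P) = (\<integral>\<^sup>+ x. indicator {0} x * indicator {0..1} x \<partial>(lborel :: real measure))"
    by (subst nn_P) (auto simp: nn_integral_multc row mult.commute)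
  also have "\<dots> = 0"
    by (subst nn_integral_0_iff_AE, measurable, use AE_lborel_singleton[of 0] in eventually_elim) auto
  finally have z: "(\<integral>\<^sup>+ p. ennreal (g p) * indicator {0} (fst p) \<partial>P) = 0" .
  have 2: "AE p in P. ennreal (g p) * indicator {0} (fst p) = 0"
    by (rule nn_integral_0_iff_AE[THEN iffD1, OF _ z]) measurable
  from 1 2 show ?thesis
  proof eventually_elim
    case (elim p)
    show ?case
    proof
      assume gp: "0 < g p"
      obtain x y where p: "p = (x, y)" by (cases p)
      have "U x y \<noteq> 0" "x \<noteq> 0" using elim gp by (auto simp: p)
      moreover have "0 \<le> x" "x \<le> 1" using gp outside[of p] by (auto simp: p)
      ultimately show "0 < h r p" using U_nonneg[of x y] E_pos[of x r]
        by (auto simp: h_def p less_le[of 0 "U x y"] intro!: divide_pos_pos mult_pos_pos)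
    qed
  qed
qed

lemma integrable_g_ln_U: "integrable P (\<lambda>p. g p * ln (U (fst p) (snd p)))"
  and integral_g_ln_U: "(\<integral>p. g p * ln (U (fst p) (snd p)) \<partial>P) = - 1"
proof -
  have nn: "0 \<le> g p * - ln (U (fst p) (snd p))" for p
  proof -
    have "ln (U (fst p) (snd p)) \<le> 0"
      using U_nonneg[of "fst p" "snd p"] U_le_1[of "fst p" "snd p"]
      by (cases "U (fst p) (snd p) = 0") (auto simp: less_le)
    then show ?thesis using nonneg by (simp add: mult_nonneg_nonpos)
  qed
  have "(\<integral>\<^sup>+ p. ennreal (g p * - ln (U (fst p) (snd p))) \<partial>P)
     = (\<integral>\<^sup>+ y. \<integral>\<^sup>+ x. ennreal (g (x, y)) * ennreal (- ln (U x y)) \<partial>lborel \<partial>lborel)"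
    unfolding ennreal_mult'[OF nonneg] by (subst nn_P') simp_all
  also have "\<dots> = (\<integral>\<^sup>+ y. (\<integral>\<^sup>+ s. ennreal (- ln s) * indicator {0..1} s \<partial>lborel) * indicator {0..1} y \<partial>(lborel :: real measure))"
    by (intro nn_integral_cong nn_integral_g_U[of "\<lambda>s. ennreal (- ln s)"]) simp
  also have "\<dots> = 1" by (simp add: nn_integral_neg_ln)
  finally have e: "(\<integral>\<^sup>+ p. ennreal (g p * - ln (U (fst p) (snd p))) \<partial>P) = 1" .
  have i: "integrable P (\<lambda>p. g p * - ln (U (fst p) (snd p)))"
    by (rule integrable_of_nn_integral[OF _ nn]) (measurable, unfold e, simp)
  have "(\<integral>p. g p * - ln (U (fst p) (snd p)) \<partial>P) = 1"
    by (subst integral_eq_nn_integral) (use nn e in auto)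
  then show "(\<integral>p. g p * ln (U (fst p) (snd p)) \<partial>P) = - 1" by simp
  show "integrable P (\<lambda>p. g p * ln (U (fst p) (snd p)))" using i by simp
qed

lemma integrable_g: "integrable P g"
  by (rule integrable_of_nn_integral) (auto simp: nonneg nn_g)

lemma integrable_g_G: "integrable P (\<lambda>p. g p * G (fst p) (snd p))"
  by (rule Bochner_Integration.integrable_bound[OF integrable_g])
    (auto simp: abs_mult nonneg intro!: mult_left_le G_le_1)

lemma integrable_g_fst:
  assumes k: "set_integrable lborel {0..1} k" and [measurable]: "k \<in> borel_measurable borel"
  shows "integrable P (\<lambda>p. g p * k (fst p))"
    and "(\<integral>p. g p * k (fst p) \<partial>P) = (LINT x:{0..1}|lborel. k x)"
proof -
  have r: "(\<integral>\<^sup>+ y. ennreal (norm (g (x, y) * k x)) \<partial>lborel) = ennreal (norm (indicator {0..1} x *\<^sub>R k x))" for x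
  proof -
    have "(\<integral>\<^sup>+ y. ennreal (norm (g (x, y) * k x)) \<partial>lborel) = (\<integral>\<^sup>+ y. ennreal (g (x, y)) * ennreal \<bar>k x\<bar> \<partial>lborel)"
      by (intro nn_integral_cong) (simp add: abs_mult nonneg ennreal_mult)
    also have "\<dots> = indicator {0..1} x * ennreal \<bar>k x\<bar>"
      by (subst nn_integral_multc) (simp_all add: row)
    finally show ?thesis by (auto split: split_indicator)
  qed
  have "(\<integral>\<^sup>+ p. ennreal (norm (g p * k (fst p))) \<partial>P) = (\<integral>\<^sup>+ x. ennreal (norm (indicator {0..1} x *\<^sub>R k x)) \<partial>lborel)"
    by (subst nn_P) (simp_all add: r del: norm_scaleR real_norm_def)
  also have "\<dots> < \<infinity>" using k unfolding set_integrable_def integrable_iff_bounded by blast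
  finally show i: "integrable P (\<lambda>p. g p * k (fst p))" unfolding integrable_iff_bounded by simp
  have "(\<integral>y. g (x, y) * k x \<partial>lborel) = indicator {0..1} x *\<^sub>R k x" for x
  proof -
    have "(\<integral>y. g (x, y) \<partial>lborel) = indicator {0..1} x"
      by (subst integral_eq_nn_integral) (auto simp: nonneg row indicator_def)
    then show ?thesis unfolding integral_mult_left_zero by simp
  qed
  note q = this
  show "(\<integral>p. g p * k (fst p) \<partial>P) = (LINT x:{0..1}|lborel. k x)"
    using lborel_pair.integral_fst'[OF i] unfolding set_lebesgue_integral_def fst_conv q by simp
qed

text \<open>Where \<open>g > 0\<close>, \<open>ln h = ln U - r G - ln (E r x)\<close>. The first term contributes \<open>- 1\<close> and the last one
depends only on the marginal in \<open>x\<close>, so \<open>\<integral> g G\<close> is all that remains of \<open>g\<close>.\<close>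

lemma cross_entropy_h:
  "integrable P (\<lambda>p. g p * ln (h r p))"
  "- (\<integral>p. g p * ln (h r p) \<partial>P) = entropy_const r + r * (\<integral>p. g p * G (fst p) (snd p) \<partial>P)"
proof -
  let ?f = "\<lambda>p. g p * ln (U (fst p) (snd p)) - r * (g p * G (fst p) (snd p)) - g p * ln (E r (fst p))"
  note k = integrable_g_fst[OF integrable_ln_E[of r], simplified]
  have fi: "integrable P ?f"
    using integrable_g_ln_U integrable_g_G k(1) by auto
  have v: "(\<integral>p. ?f p \<partial>P) = - 1 - r * (\<integral>p. g p * G (fst p) (snd p) \<partial>P) - (LINT x:{0..1}|lborel. ln (E r x))"
    using integrable_g_ln_U integrable_g_G k by (simp add: integral_g_ln_U)
  have ae: "AE p in P. g p * ln (h r p) = ?f p"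
    using AE_g_h_pos[of r]
  proof eventually_elim
    case (elim p)
    show ?case
    proof (cases "g p = 0")
      case False
      with nonneg[of p] elim have hp: "0 < h r p" by simp
      obtain x y where p: "p = (x, y)" by (cases p)
      from hp have x: "0 < x" "x \<le> 1" by (auto simp: h_def p split: if_splits)
      with hp have "0 < U x y" using U_nonneg[of x y] by (auto simp: h_def p less_le)
      then have "ln (h r p) = ln (U x y) - r * G x y - ln (E r x)"
        using x E_pos[of x r] by (simp add: h_def p ln_div ln_mult)
      then show ?thesis by (simp add: p right_diff_distrib)
    qed simp
  qed
  show "integrable P (\<lambda>p. g p * ln (h r p))"
    by (rule integrable_cong_AE[THEN iffD2, OF _ _ ae fi]) measurable
  have "(\<integral>p. g p * ln (h r p) \<partial>P) = (\<integral>p. ?f p \<partial>P)"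
    by (rule integral_cong_AE[OF _ _ ae]) measurable
  then show "- (\<integral>p. g p * ln (h r p) \<partial>P) = entropy_const r + r * (\<integral>p. g p * G (fst p) (snd p) \<partial>P)"
    by (simp add: v entropy_const_def)
qed

lemma entropy_bound:
  "entropy_of P g \<le> ereal (entropy_const r + r * (\<integral>p. g p * G (fst p) (snd p) \<partial>P))"
  "entropy_of P g = ereal (entropy_const r + r * (\<integral>p. g p * G (fst p) (snd p) \<partial>P)) \<longleftrightarrow> (AE p in P. g p = h r p)"
proof -
  have g': "g \<in> borel_measurable P" "h r \<in> borel_measurable P" by measurable
  note * = gibbs[OF g' nonneg h_nonneg[of r] nn_g nn_h[of r] AE_g_h_pos[of r] cross_entropy_h(1)[of r], unfolded cross_entropy_h(2)]
  show "entropy_of P g \<le> ereal (entropy_const r + r * (\<integral>p. g p * G (fst p) (snd p) \<partial>P))"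
    by (rule *(1))
  have "entropy_of P g = ereal (entropy_const r + r * (\<integral>p. g p * G (fst p) (snd p) \<partial>P))" if ae: "AE p in P. g p = h r p"
  proof -
    have ae': "AE p in P. g p * ln (h r p) = g p * ln (g p)" using ae by eventually_elim simp
    have i: "integrable P (\<lambda>p. g p * ln (g p))"
      by (rule integrable_cong_AE[THEN iffD1, OF _ _ ae' cross_entropy_h(1)]) measurable
    have "(\<integral>p. g p * ln (g p) \<partial>P) = (\<integral>p. g p * ln (h r p) \<partial>P)"
      by (rule integral_cong_AE[OF _ _ ae', symmetric]) measurable
    then show ?thesis using entropy_of_integrable[OF i] cross_entropy_h(2)[of r] by simp
  qed
  with *(2) show "entropy_of P g = ereal (entropy_const r + r * (\<integral>p. g p * G (fst p) (snd p) \<partial>P)) \<longleftrightarrow> (AE p in P. g p = h r p)"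
    by blast
qed

end

section \<open>The equality case\<close>

context copula_density
begin

lemma continuous_G: "continuous_on UNIV (\<lambda>x. G x y)"
proof -
  obtain m where m: "(\<integral>\<^sup>+ t. ennreal (V t y) \<partial>lborel) = ennreal m" "0 \<le> m"
    using nn_V[of y] by (cases "(\<integral>\<^sup>+ t. ennreal (V t y) \<partial>lborel)") auto
  show ?thesis unfolding G_eq_cumul_V by (rule distr_cumul(3)[OF _ m]) measurable
qed

context
  fixes r :: real
  assumes sol: "AE p in P. g p = h r p"
begin

text \<open>When \<open>g = h\<close>, the integral of \<open>g G\<close> along a vertical line is the mean of the truncated exponential law on \<open>[0,x]\<close>.\<close>

lemma extremal_integral_G: "(\<integral>p. g p * G (fst p) (snd p) \<partial>P) = rho_real r / 2"
proof -
  have "(\<integral>\<^sup>+ p. ennreal (g p * G (fst p) (snd p)) \<partial>P) = (\<integral>\<^sup>+ p. ennreal (h r p * max 0 (G (fst p) (snd p))) \<partial>P)"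
    using sol by (intro nn_integral_cong_AE) (auto elim!: eventually_mono simp: max_def)
  also have "\<dots> = (\<integral>\<^sup>+ x. \<integral>\<^sup>+ v. ennreal (h r (x, v) * max 0 (G x v)) \<partial>lborel \<partial>lborel)"
    by (subst nn_P) simp_all
  also have "\<dots> = (\<integral>\<^sup>+ x. ennreal (x * trunc_mean (r * x)) * indicator {0..1} x \<partial>lborel)"
  proof (rule nn_integral_cong)
    fix x
    show "(\<integral>\<^sup>+ v. ennreal (h r (x, v) * max 0 (G x v)) \<partial>lborel) = ennreal (x * trunc_mean (r * x)) * indicator {0..1} x"
    proof (cases "0 < x \<and> x \<le> 1")
      case True
      then have x: "0 < x" "x \<le> 1" by auto
      have "(\<integral>\<^sup>+ v. ennreal (h r (x, v) * max 0 (G x v)) \<partial>lborel)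
         = (\<integral>\<^sup>+ s. ennreal (max 0 s * exp (- r * s) / E r x) * indicator {0..x} s \<partial>lborel)"
        by (rule nn_integral_h_G_full) (use x in auto)
      also have "\<dots> = (\<integral>\<^sup>+ s. ennreal (s * exp (- r * s) / E r x) * indicator {0..x} s \<partial>lborel)"
        by (intro nn_integral_cong) (auto split: split_indicator)
      finally show ?thesis using x nn_integral_mean_E[OF x(1), of r] by simp
    qed (auto simp: h_def split: split_indicator)
  qed
  finally have e: "(\<integral>\<^sup>+ p. ennreal (g p * G (fst p) (snd p)) \<partial>P) = ennreal (rho_real r / 2)"
    by (simp add: nn_integral_rho)
  have "0 \<le> rho_real r / 2"
    unfolding rho_real_def by (auto intro!: integral_nonneg integrable_continuous_real continuous_rho_integrand mult_nonneg_nonneg trunc_mean_nonneg)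
  then show ?thesis
    by (subst integral_eq_nn_integral) (use nonneg e in auto)
qed

text \<open>Integrating \<open>g = h\<close> in \<open>y\<close> by the substitution \<open>s = G x y\<close>. As \<open>V = \<partial>G/\<partial>x\<close>, this is a differential
equation for \<open>G\<close> in \<open>x\<close>, known for almost every \<open>x\<close>.\<close>

lemma extremal_V: "AE x in lborel. 0 < x \<and> x \<le> 1 \<longrightarrow> (\<forall>y. V x y = E r (G x y) / E r x)"
  using lborel_pair.AE_pair[OF sol]
proof eventually_elim
  case (elim x)
  show ?case
  proof (intro impI allI)
    fix y assume x: "0 < x \<and> x \<le> 1"
    have "ennreal (V x y) = (\<integral>\<^sup>+ v. ennreal (h r (x, v) * 1) * indicator {..y} v \<partial>lborel)"
      unfolding ennreal_V using elim by (intro nn_integral_cong_AE) (auto elim!: eventually_mono)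
    also have "\<dots> = (\<integral>\<^sup>+ s. ennreal (1 * exp (- r * s) / E r x) * indicator {0..G x y} s \<partial>lborel)"
      by (rule nn_integral_h_G) (use x in auto)
    also have "\<dots> = ennreal (E r (G x y) / E r x)"
      using x by (intro nn_integral_exp_quot) auto
    finally have "ennreal (V x y) = ennreal (E r (G x y) / E r x)" .
    moreover have "0 \<le> E r (G x y) / E r x"
      using E_pos[of x r] E_pos[of "G x y" r] G_nonneg[of x y] x
      by (cases "G x y = 0") (auto simp: less_le)
    ultimately show "V x y = E r (G x y) / E r x" by simp
  qed
qed

text \<open>The equation \<open>\<partial>G/\<partial>x = E r G / E r x\<close> has a continuous right-hand side, so it holds at every \<open>x\<close> in \<open>(0,1)\<close>.
It is separable, and \<open>E (- r) G / E (- r) x\<close> is a first integral, whose value is read off at \<open>x = 1\<close>.\<close>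

lemma extremal_G:
  assumes x: "0 < x" "x \<le> 1" and y: "0 \<le> y" "y \<le> 1"
  shows "E (- r) (G x y) / E (- r) x = E (- r) y / E (- r) 1"
proof (cases "x = 1")
  case True then show ?thesis using G_right[OF y] by simp
next
  case False
  define w where "w t = E r (G t y) / E r t" for t
  have cEG: "continuous_on S (\<lambda>t. E q (G t y))" for S q
    by (rule continuous_on_compose2[OF continuous_on_E continuous_on_subset[OF continuous_G subset_UNIV] subset_UNIV])
  have cw: "continuous_on {a..b} w" if "0 < a" for a b
    unfolding w_def
  proof (rule continuous_on_divide)
    show "continuous_on {a..b} (\<lambda>t. E r (G t y))" by (rule cEG)
    show "\<forall>t\<in>{a..b}. E r t \<noteq> 0" using that E_nonzero by auto
  qed (rule continuous_on_E)
  have Gd: "G b y - G a y = integral {a..b} w" if ab: "0 < a" "a \<le> b" "b \<le> 1" for a b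
    unfolding G_eq_cumul_V
  proof (rule cumul_diff[OF _ _ nn_V ab(2) cw[OF ab(1)]])
    show "AE t in lborel. a < t \<longrightarrow> t < b \<longrightarrow> V t y = w t"
      using extremal_V by eventually_elim (use ab in \<open>auto simp: w_def\<close>)
  qed auto
  let ?D = "\<lambda>x. E (- r) (G x y) / E (- r) x"
  have d: "(?D has_real_derivative 0) (at s)" if s: "0 < s" "s < 1" for s
  proof -
    \<comment> \<open>The equation is integrated from \<open>s/2\<close>, since \<open>w\<close> is a quotient \<open>0 / 0\<close> at \<open>0\<close>.\<close>
    have "((\<lambda>x. integral {s/2..x} w) has_real_derivative w s) (at s within {s/2..1})"
      by (rule integral_has_real_derivative) (use s cw[of "s/2" 1] in auto)
    then have "((\<lambda>x. integral {s/2..x} w) has_real_derivative w s) (at s)"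
      using s by (simp add: at_within_Icc_at)
    then have "((\<lambda>x. G (s/2) y + integral {s/2..x} w) has_real_derivative 0 + w s) (at s)"
      by (rule DERIV_add[OF DERIV_const])
    then have "((\<lambda>x. G (s/2) y + integral {s/2..x} w) has_real_derivative w s) (at s)"
      by simp
    then have dG: "((\<lambda>x. G x y) has_real_derivative w s) (at s)"
    proof (rule has_field_derivative_transform_within_open[of _ _ _ "{s/2<..<1}"])
      fix t assume "t \<in> {s/2<..<1}"
      then show "G (s/2) y + integral {s/2..t} w = G t y"
        using Gd[of "s/2" t] s by auto
    qed (use s in auto)
    have Es: "0 < E (- r) s" "0 < E r s" using s E_pos by auto
    have "(?D has_real_derivative ((exp (- (- r) * G s y) * w s) * E (- r) s - E (- r) (G s y) * exp (- (- r) * s)) / (E (- r) s * E (- r) s)) (at s)"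
      by (rule DERIV_divide[OF DERIV_chain2[OF DERIV_E dG] DERIV_E]) (use Es in auto)
    moreover have "w s = exp (- r * G s y) * E (- r) (G s y) / (exp (- r * s) * E (- r) s)"
      unfolding w_def E_flip by simp
    then have "(exp (- (- r) * G s y) * w s) * E (- r) s - E (- r) (G s y) * exp (- (- r) * s) = 0"
      using Es by (simp add: exp_minus field_simps)
    ultimately show ?thesis by simp
  qed
  have "?D 1 = ?D x"
  proof (rule DERIV_isconst_end[of x 1 ?D])
    show "x < 1" using x False by simp
    show "continuous_on {x..1} ?D"
    proof (rule continuous_on_divide)
      show "continuous_on {x..1} (\<lambda>t. E (- r) (G t y))" by (rule cEG)
      show "\<forall>t\<in>{x..1}. E (- r) t \<noteq> 0" using x E_nonzero by auto
    qed (rule continuous_on_E)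
  qed (use d x in auto)
  then show ?thesis using G_right[OF y] by simp
qed

end

end

text \<open>By \<open>extremal_G\<close> and injectivity of \<open>E (- r)\<close> the two distribution functions agree; then so do the functions
\<open>V\<close> by the differential equation, and \<open>V x\<close> is the distribution function of the section of \<open>g\<close> at \<open>x\<close>.\<close>

lemma extremal_unique:
  assumes 1: "copula_density g\<^sub>1" and 2: "copula_density g\<^sub>2"
    and sol1: "AE p in lborel \<Otimes>\<^sub>M lborel. g\<^sub>1 p = copula_density.h g\<^sub>1 r p"
    and sol2: "AE p in lborel \<Otimes>\<^sub>M lborel. g\<^sub>2 p = copula_density.h g\<^sub>2 r p"
  shows "AE p in lborel \<Otimes>\<^sub>M lborel. g\<^sub>1 p = g\<^sub>2 p"
proof -
  interpret A: copula_density g\<^sub>1 by fact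
  interpret B: copula_density g\<^sub>2 by fact
  have G: "A.G x y = B.G x y" if x: "0 < x" "x \<le> 1" and y: "0 \<le> y" "y \<le> 1" for x y
  proof -
    have "E (- r) (A.G x y) / E (- r) x = E (- r) (B.G x y) / E (- r) x"
      using A.extremal_G[OF sol1 x y] B.extremal_G[OF sol2 x y] by simp
    then have "E (- r) (A.G x y) = E (- r) (B.G x y)" using E_pos[OF x(1), of "- r"] by simp
    then show ?thesis by (rule E_inj)
  qed
  have "AE x in lborel. AE y in lborel. g\<^sub>1 (x, y) = g\<^sub>2 (x, y)"
    using A.extremal_V[OF sol1] B.extremal_V[OF sol2] AE_lborel_singleton[of 0]
  proof eventually_elim
    case (elim x)
    show ?case
    proof (cases "0 < x \<and> x \<le> 1")
      case True
      then have x: "0 < x" "x \<le> 1" by auto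
      have V: "A.V x y = B.V x y" for y
      proof -
        consider "0 \<le> y" "y \<le> 1" | "1 < y" | "y < 0" by linarith
        then show ?thesis
        proof cases
          case 1 then show ?thesis using elim x G by simp
        next
          case 2
          then have "ennreal (A.V x y) = ennreal (B.V x y)" using A.V_full[of y x] B.V_full[of y x] by simp
          then show ?thesis by simp
        next
          case 3
          have "A.V x y = 0" if "y < 0"
            unfolding A.V_def cumul_def using that A.outside
            by (subst nn_integral_0_iff_AE[THEN iffD2]) (auto split: split_indicator)
          moreover have "B.V x y = 0" if "y < 0"
            unfolding B.V_def cumul_def using that B.outside
            by (subst nn_integral_0_iff_AE[THEN iffD2]) (auto split: split_indicator)
          ultimately show ?thesis using 3 by simp
        qed
      qed
      show ?thesis
        by (rule AE_eq_of_cumul_eq)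
          (use V A.row_fin B.row_fin in \<open>auto simp: A.nonneg B.nonneg A.V_def B.V_def\<close>)
    next
      case False
      then have "(x, y) \<notin> unit_square" for y using elim by auto
      then show ?thesis using A.outside B.outside by simp
    qed
  qed
  moreover have "{p \<in> space (lborel \<Otimes>\<^sub>M lborel). g\<^sub>1 p = g\<^sub>2 p} \<in> sets (lborel \<Otimes>\<^sub>M lborel)"
    using A.meas B.meas by measurable
  ultimately show ?thesis by (intro lborel_pair.AE_pair_measure)
qed

section \<open>The Frank copula\<close>

text \<open>The exponential \<open>exp (r * G x y)\<close> of the Frank copula \<open>G\<close>, which solves
\<open>E (- r) G * E (- r) 1 = E (- r) x * E (- r) y\<close>. The density and \<open>frank_G\<close> below are obtained from it by
differentiating and by taking the logarithm.\<close>

definition frank :: "real \<Rightarrow> real \<Rightarrow> real \<Rightarrow> real" where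
  "frank r x y = 1 + r * E (- r) x * E (- r) y / E (- r) 1"

definition frank_density :: "real \<Rightarrow> real \<Rightarrow> real \<Rightarrow> real" where
  "frank_density r x y = exp (r * x) * exp (r * y) / (E (- r) 1 * (frank r x y)\<^sup>2)"

lemma frank_sym: "frank r x y = frank r y x"
  by (simp add: frank_def mult_ac)

lemma frank_density_sym: "frank_density r x y = frank_density r y x"
  by (simp add: frank_density_def frank_sym[of r x y] mult_ac)

text \<open>A convex combination of \<open>1\<close> and \<open>exp (r * x)\<close>, with weight \<open>E (- r) y / E (- r) 1\<close> on the latter.\<close>

lemma frank_pos:
  assumes "0 \<le> x" "x \<le> 1" "0 \<le> y" "y \<le> 1" shows "0 < frank r x y"
proof -
  define t where "t = E (- r) y / E (- r) 1"
  have E1: "0 < E (- r) 1" by simp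
  have "0 \<le> E (- r) y" using E_pos[of y "- r"] assms by (cases "y = 0") auto
  moreover have "E (- r) y \<le> E (- r) 1" using E_strict_mono[of y 1 "- r"] assms by (cases "y = 1") auto
  ultimately have t: "0 \<le> t" "t \<le> 1" using E1 by (auto simp: t_def)
  have "exp (r * x) = 1 + r * E (- r) x" using exp_E[of "- r" x] by simp
  then have "frank r x y = (1 - t) * 1 + t * exp (r * x)" by (simp add: frank_def t_def field_simps)
  also have "\<dots> > 0"
  proof (cases "t = 0")
    case False
    then have "0 < t * exp (r * x)" using t by simp
    then show ?thesis using t by (intro add_nonneg_pos) auto
  qed simp
  finally show ?thesis .
qed

lemma frank_1: "frank r 1 y = exp (r * y)"
  using exp_E[of "- r" y] by (simp add: frank_def)

lemma DERIV_frank: "((\<lambda>x. frank r x y) has_real_derivative r * exp (r * x) * E (- r) y / E (- r) 1) (at x)"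
  unfolding frank_def[abs_def]
  by (auto intro!: derivative_eq_intros DERIV_E)

lemma frank_U_nonneg:
  assumes "0 \<le> x" "x \<le> 1" "0 \<le> y" "y \<le> 1"
  shows "0 \<le> exp (r * y) / E (- r) 1 * (E (- r) x / frank r x y)"
  using frank_pos[OF assms, of r] assms
  by (intro mult_nonneg_nonneg divide_nonneg_nonneg E_nonneg) auto

lemma DERIV_frank_U:
  assumes "0 \<le> x" "x \<le> 1" "0 \<le> y" "y \<le> 1"
  shows "((\<lambda>x. exp (r * y) / E (- r) 1 * (E (- r) x / frank r x y)) has_real_derivative frank_density r x y) (at x)"
proof -
  have Q: "0 < frank r x y" using frank_pos[OF assms] .
  have E1: "0 < E (- r) 1" by simp
  have "((\<lambda>x. exp (r * y) / E (- r) 1 * (E (- r) x / frank r x y)) has_real_derivative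
     exp (r * y) / E (- r) 1 * ((exp (- (- r) * x) * frank r x y - E (- r) x * (r * exp (r * x) * E (- r) y / E (- r) 1)) / (frank r x y * frank r x y))) (at x)"
    by (intro DERIV_cmult DERIV_divide DERIV_E DERIV_frank) (use Q in auto)
  moreover have "exp (- (- r) * x) * frank r x y - E (- r) x * (r * exp (r * x) * E (- r) y / E (- r) 1) = exp (r * x)"
    by (simp add: frank_def algebra_simps)
  ultimately show ?thesis using Q E1 by (simp add: frank_density_def power2_eq_square mult_ac)
qed

definition frank_G :: "real \<Rightarrow> real \<Rightarrow> real \<Rightarrow> real" where
  "frank_G r x y = (if r = 0 then x * y else ln (frank r x y) / r)"

lemma exp_frank_G:
  assumes "0 \<le> x" "x \<le> 1" "0 \<le> y" "y \<le> 1" shows "exp (- r * frank_G r x y) = 1 / frank r x y"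
  using frank_pos[OF assms, of r] by (auto simp: frank_G_def exp_minus inverse_eq_divide) (simp add: frank_def)

lemma DERIV_frank_G:
  assumes "0 \<le> x" "x \<le> 1" "0 \<le> y" "y \<le> 1"
  shows "((\<lambda>y. frank_G r x y) has_real_derivative exp (r * y) / E (- r) 1 * (E (- r) x / frank r x y)) (at y)"
proof (cases "r = 0")
  case True
  then show ?thesis by (auto simp: frank_G_def E_def frank_def intro!: derivative_eq_intros)
next
  case False
  have Q: "0 < frank r y x" using frank_pos[OF assms, of r] frank_sym[of r x y] by simp
  have "((\<lambda>y. ln (frank r y x) / r) has_real_derivative (1 / frank r y x * (r * exp (r * y) * E (- r) x / E (- r) 1)) / r) (at y)"
    by (intro DERIV_cdivide DERIV_chain2[OF DERIV_ln_divide DERIV_frank] Q)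
  then show ?thesis using False unfolding frank_G_def frank_sym[of r x] by (simp add: mult_ac)
qed

definition frank_g :: "real \<Rightarrow> real \<times> real \<Rightarrow> real" where
  "frank_g r = (\<lambda>(x, y). frank_density r x y * indicator unit_square (x, y))"

lemma measurable_frank_density [measurable]:
  assumes [measurable]: "f \<in> borel_measurable N" "k \<in> borel_measurable N"
  shows "(\<lambda>p. frank_density r (f p) (k p)) \<in> borel_measurable N"
  unfolding frank_density_def frank_def by measurable

lemma frank_density_nonneg: "0 \<le> frank_density r x y"
  unfolding frank_density_def using E_pos[of 1 "- r"] by simp

lemma continuous_frank_U:
  "0 \<le> y \<Longrightarrow> y \<le> 1 \<Longrightarrow> b \<le> 1 \<Longrightarrow> continuous_on {0..b} (\<lambda>x. exp (r * y) / E (- r) 1 * (E (- r) x / frank r x y))"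
  by (intro continuous_at_imp_continuous_on ballI DERIV_isCont[OF DERIV_frank_U]) auto

lemma nn_integral_frank_density:
  assumes y: "0 \<le> y" "y \<le> 1" and x: "0 \<le> x" "x \<le> 1"
  shows "(\<integral>\<^sup>+ t. ennreal (frank_density r t y) * indicator {0..x} t \<partial>lborel) = ennreal (exp (r * y) / E (- r) 1 * (E (- r) x / frank r x y))"
proof -
  let ?F = "\<lambda>x. exp (r * y) / E (- r) 1 * (E (- r) x / frank r x y)"
  have "(\<integral>\<^sup>+ t. ennreal (frank_density r t y) * indicator {0..x} t \<partial>lborel) = ennreal (?F x - ?F 0)"
  proof (rule nn_integral_FTC_Icc_interior[OF _ x(1)])
    show "continuous_on {0..x} ?F" by (rule continuous_frank_U[OF y x(2)])
    fix t assume "0 < t" "t < x"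
    then show "(?F has_real_derivative frank_density r t y) (at t)"
      using x y by (intro DERIV_frank_U) auto
  qed (auto intro: frank_density_nonneg)
  then show ?thesis by simp
qed

lemma frank_col: "(\<integral>\<^sup>+ x. ennreal (frank_g r (x, y)) \<partial>lborel) = indicator {0..1} y"
proof (cases "y \<in> {0..1}")
  case True
  have "(\<integral>\<^sup>+ x. ennreal (frank_g r (x, y)) \<partial>lborel) = (\<integral>\<^sup>+ t. ennreal (frank_density r t y) * indicator {0..1} t \<partial>lborel)"
    using True by (intro nn_integral_cong) (auto simp: frank_g_def split: split_indicator)
  then show ?thesis
    using True E_pos[of 1 "- r"] by (simp add: nn_integral_frank_density frank_1)
qed (auto simp: frank_g_def)

lemma frank_g_sym: "frank_g r (x, y) = frank_g r (y, x)"
  using frank_density_sym[of r x y] by (auto simp: frank_g_def split: split_indicator)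

lemma copula_frank: "copula_density (frank_g r)"
proof
  show "frank_g r \<in> borel_measurable (borel \<Otimes>\<^sub>M borel)"
    unfolding frank_g_def by measurable
  show "0 \<le> frank_g r p" for p
    by (cases p) (simp add: frank_g_def frank_density_nonneg)
  show "(\<integral>\<^sup>+ x. ennreal (frank_g r (x, y)) \<partial>lborel) = indicator {0..1} y" for y
    by (rule frank_col)
  show "(\<integral>\<^sup>+ y. ennreal (frank_g r (x, y)) \<partial>lborel) = indicator {0..1} x" for x
    unfolding frank_g_sym[of r x] by (rule frank_col)
  show "p \<notin> unit_square \<Longrightarrow> frank_g r p = 0" for p
    by (cases p) (simp add: frank_g_def)
qed

interpretation frank: copula_density "frank_g r" for r
  by (rule copula_frank)

lemma frank_U:
  assumes y: "0 \<le> y" "y \<le> 1" and x: "0 \<le> x" "x \<le> 1"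
  shows "frank.U r x y = exp (r * y) / E (- r) 1 * (E (- r) x / frank r x y)" (is "_ = ?u")
proof -
  have "ennreal (frank.U r x y) = (\<integral>\<^sup>+ t. ennreal (frank_density r t y) * indicator {0..x} t \<partial>lborel)"
    unfolding frank.ennreal_U using x y
    by (intro nn_integral_cong) (auto simp: frank_g_def split: split_indicator)
  also have "\<dots> = ennreal ?u" by (rule nn_integral_frank_density[OF y x])
  finally have "ennreal (frank.U r x y) = ennreal ?u" .
  moreover have "0 \<le> ?u"
    using x y by (intro frank_U_nonneg)
  ultimately show ?thesis by simp
qed

lemma frank_G:
  assumes y: "0 \<le> y" "y \<le> 1" and x: "0 \<le> x" "x \<le> 1"
  shows "frank.G r x y = frank_G r x y"
proof -
  have [measurable]: "frank r x \<in> borel_measurable borel" unfolding frank_def by measurable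
  have "ennreal (frank.G r x y) = (\<integral>\<^sup>+ v. ennreal (exp (r * v) / E (- r) 1 * (E (- r) x / frank r x v)) * indicator {0..y} v \<partial>lborel)"
    unfolding frank.ennreal_G using x y
    by (intro nn_integral_cong) (auto simp: frank_U frank.U_zero split: split_indicator)
  also have "\<dots> = ennreal (frank_G r x y - frank_G r x 0)"
  proof (rule nn_integral_FTC_Icc_interior[OF _ y(1)])
    show "continuous_on {0..y} (frank_G r x)"
      using x y by (intro continuous_at_imp_continuous_on ballI DERIV_isCont[OF DERIV_frank_G]) auto
    fix v assume "0 < v" "v < y"
    then show "0 \<le> exp (r * v) / E (- r) 1 * (E (- r) x / frank r x v)"
      using x y by (intro frank_U_nonneg) auto
    show "(frank_G r x has_real_derivative exp (r * v) / E (- r) 1 * (E (- r) x / frank r x v)) (at v)"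
      using \<open>0 < v\<close> \<open>v < y\<close> x y by (intro DERIV_frank_G) auto
  qed measurable
  finally have *: "ennreal (frank.G r x y) = ennreal (frank_G r x y - frank_G r x 0)" .
  have 0: "frank_G r x 0 = 0" by (simp add: frank_G_def frank_def)
  have "frank_G r x 0 \<le> frank_G r x y"
  proof (rule DERIV_nonneg_imp_nondecreasing[OF y(1)])
    fix v assume "0 \<le> v" "v \<le> y"
    then have v: "0 \<le> v" "v \<le> 1" using y by auto
    show "\<exists>d. (frank_G r x has_real_derivative d) (at v) \<and> 0 \<le> d"
      using DERIV_frank_G[OF x v] frank_U_nonneg[OF x v] by blast
  qed
  with * 0 show ?thesis by simp
qed

lemma frank_extremal: "AE p in lborel \<Otimes>\<^sub>M lborel. frank_g r p = frank.h r r p"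
proof (rule lborel_pair.AE_pair_measure)
  show "AE x in lborel. AE y in lborel. frank_g r (x, y) = frank.h r r (x, y)"
    using AE_lborel_singleton[of 0]
  proof eventually_elim
    case (elim x)
    have "frank_g r (x, y) = frank.h r r (x, y)" for y
    proof (cases "0 < x \<and> x \<le> 1 \<and> 0 \<le> y \<and> y \<le> 1")
      case True
      then have x: "0 \<le> x" "x \<le> 1" "0 < x" and y: "0 \<le> y" "y \<le> 1" by auto
      have Q: "0 < frank r x y" using frank_pos[OF x(1,2) y] .
      have "frank.h r r (x, y) = exp (r * y) / E (- r) 1 * (E (- r) x / frank r x y) * (1 / frank r x y) / (exp (- r * x) * E (- r) x)"
        unfolding E_flip using x by (simp add: frank.h_def frank_U[OF y x(1,2)] frank_G[OF y x(1,2)] exp_frank_G[OF x(1,2) y, simplified])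
      also have "\<dots> = frank_density r x y"
        using Q E_pos[OF x(3), of "- r"] E_pos[of 1 "- r"]
        by (simp add: frank_density_def power2_eq_square exp_minus field_simps)
      finally show ?thesis using x y by (simp add: frank_g_def)
    next
      case False
      then have "(x, y) \<notin> unit_square" using elim by auto
      then have "frank_g r (x, y) = 0" by (rule frank.outside)
      moreover have "frank.h r r (x, y) = 0"
        using False frank.U_zero[of y r x] by (auto simp: frank.h_def)
      ultimately show ?thesis by simp
    qed
    then show ?case by simp
  qed
  show "{p \<in> space (lborel \<Otimes>\<^sub>M lborel). frank_g r p = frank.h r r p} \<in> sets (lborel \<Otimes>\<^sub>M lborel)"
    using frank.meas frank.measurable_h by measurable
qed

text \<open>Both sides are rational in \<open>X = exp (r x / 2)\<close>, \<open>Y = exp (r y / 2)\<close> and \<open>Z = exp (r / 2)\<close>, and both denominators are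
multiples of the square of \<open>N = Z\<^sup>2 - X\<^sup>2 - Y\<^sup>2 + X\<^sup>2 Y\<^sup>2\<close>.\<close>

lemma max_density_eq:
  "max_density r (x, y) = frank_density r x y"
proof (cases "r = 0")
  case True
  then show ?thesis by (simp add: max_density_def frank_density_def frank_def E_def)
next
  case False
  define X where "X = exp (r * x / 2)"
  define Y where "Y = exp (r * y / 2)"
  define Z where "Z = exp (r / 2)"
  have pos: "0 < X" "0 < Y" "0 < Z" by (auto simp: X_def Y_def Z_def)
  have X2: "exp (r * x) = X\<^sup>2" "exp (r * y) = Y\<^sup>2" "exp r = Z\<^sup>2" "exp (- r) = 1 / Z\<^sup>2"
    by (simp_all add: X_def Y_def Z_def exp_minus inverse_eq_divide flip: exp_double)
  have Z1: "Z\<^sup>2 \<noteq> 1" using False X2(3) by (metis exp_eq_one_iff)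
  have e: "exp (r * (1 - x - y) / 2) = Z / (X * Y)" "exp (r * (x - y - 1) / 2) = X / (Y * Z)"
    "exp (r * (y - x - 1) / 2) = Y / (X * Z)" "exp (r * (x + y - 1) / 2) = X * Y / Z"
    by (simp_all add: X_def Y_def Z_def flip: exp_add exp_diff) (simp_all add: field_simps)
  define N where "N = Z\<^sup>2 - X\<^sup>2 - Y\<^sup>2 + X\<^sup>2 * Y\<^sup>2"
  have "Z / (X * Y) - X / (Y * Z) - Y / (X * Z) + X * Y / Z = N / (X * Y * Z)"
    using pos by (simp add: N_def field_simps power2_eq_square)
  then have 1: "max_density r (x, y) = r * (1 - 1 / Z\<^sup>2) / (N / (X * Y * Z))\<^sup>2"
    using False by (simp add: max_density_def e X2)
  have E: "E (- r) x = (X\<^sup>2 - 1) / r" "E (- r) y = (Y\<^sup>2 - 1) / r" "E (- r) 1 = (Z\<^sup>2 - 1) / r"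
    using False by (simp_all add: E_def X2 field_simps)
  have "frank r x y = N / (Z\<^sup>2 - 1)"
    unfolding frank_def E using False Z1 by (simp add: N_def field_simps)
  then have 2: "frank_density r x y = X\<^sup>2 * Y\<^sup>2 / ((Z\<^sup>2 - 1) / r * (N / (Z\<^sup>2 - 1))\<^sup>2)"
    by (simp add: frank_density_def E X2)
  show ?thesis
  proof (cases "N = 0")
    case True then show ?thesis unfolding 1 2 by simp
  next
    case False
    then show ?thesis unfolding 1 2 using pos Z1 \<open>r \<noteq> 0\<close>
      by (simp add: field_simps power2_eq_square)
  qed
qed

section \<open>Permutons and their densities\<close>

definition permuton_of :: "(real \<times> real \<Rightarrow> real) \<Rightarrow> (real \<times> real) measure" where
  "permuton_of g = density lborel_square (\<lambda>p. ennreal (g p))"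

lemma sets_lborel_pair: "sets (lborel :: (real \<times> real) measure) = sets (borel \<Otimes>\<^sub>M borel)"
  by (simp only: borel_prod sets_lborel)

lemma unit_square_lborel: "unit_square \<inter> space lborel \<in> sets (lborel :: (real \<times> real) measure)"
  by (simp add: borel_closed closed_Times)

lemma unit_square_sets [measurable]: "unit_square \<in> sets (borel \<Otimes>\<^sub>M borel)"
  by simp

lemma measurable_lborel_square:
  "f \<in> measurable (borel \<Otimes>\<^sub>M borel) N \<Longrightarrow> f \<in> measurable lborel_square N"
  by (intro measurable_restrict_space1) (simp only: measurable_cong_sets[OF sets_lborel_pair refl])

lemma sets_permuton_of: "sets (permuton_of g) = sets (restrict_space borel unit_square)"
  unfolding permuton_of_def sets_density by (rule sets_restrict_space_cong) simp

lemma measurable_permuton_of: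
  "f \<in> measurable (borel \<Otimes>\<^sub>M borel) N \<Longrightarrow> f \<in> measurable (permuton_of g) N"
  unfolding permuton_of_def measurable_density_eq1
  by (rule measurable_lborel_square)

lemma nn_integral_permuton_of:
  assumes g [measurable]: "g \<in> borel_measurable (borel \<Otimes>\<^sub>M borel)"
    and out: "\<And>p. p \<notin> unit_square \<Longrightarrow> g p = 0"
    and f [measurable]: "f \<in> borel_measurable (borel \<Otimes>\<^sub>M borel)"
  shows "(\<integral>\<^sup>+ p. f p \<partial>permuton_of g) = (\<integral>\<^sup>+ p. ennreal (g p) * f p \<partial>(lborel \<Otimes>\<^sub>M lborel))"
proof -
  have "(\<integral>\<^sup>+ p. f p \<partial>permuton_of g) = (\<integral>\<^sup>+ p. ennreal (g p) * f p \<partial>lborel_square)"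
    unfolding permuton_of_def
    by (intro nn_integral_density measurable_lborel_square) measurable
  also have "\<dots> = (\<integral>\<^sup>+ p. ennreal (g p) * f p * indicator unit_square p \<partial>lborel)"
    by (rule nn_integral_restrict_space[OF unit_square_lborel])
  also have "\<dots> = (\<integral>\<^sup>+ p. ennreal (g p) * f p \<partial>lborel)"
    using out by (intro nn_integral_cong) (auto split: split_indicator)
  finally show ?thesis by (simp add: lborel_prod)
qed

lemma density_entropy_eq:
  assumes g [measurable]: "g \<in> borel_measurable (borel \<Otimes>\<^sub>M borel)"
    and out: "\<And>p. p \<notin> unit_square \<Longrightarrow> g p = 0"
  shows "density_entropy g = entropy_of (lborel \<Otimes>\<^sub>M lborel) g"
proof -
  have "(\<integral>\<^sup>+ p. ennreal (F (g p)) \<partial>lborel_square) = (\<integral>\<^sup>+ p. ennreal (F (g p)) \<partial>(lborel \<Otimes>\<^sub>M lborel))"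
    if "F 0 = 0" for F :: "real \<Rightarrow> real"
  proof -
    have "(\<integral>\<^sup>+ p. ennreal (F (g p)) \<partial>lborel_square) = (\<integral>\<^sup>+ p. ennreal (F (g p)) * indicator unit_square p \<partial>lborel)"
      by (rule nn_integral_restrict_space[OF unit_square_lborel])
    also have "\<dots> = (\<integral>\<^sup>+ p. ennreal (F (g p)) \<partial>lborel)"
      using out that by (intro nn_integral_cong) (auto split: split_indicator)
    finally show ?thesis by (simp add: lborel_prod)
  qed
  from this[of "\<lambda>t. - t * ln t"] this[of "\<lambda>t. t * ln t"] show ?thesis
    by (simp add: density_entropy_def entropy_of_def)
qed

lemma permuton_of_cong_AE:
  assumes [measurable]: "f \<in> borel_measurable (borel \<Otimes>\<^sub>M borel)" "g \<in> borel_measurable (borel \<Otimes>\<^sub>M borel)"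
    and ae: "AE p in lborel \<Otimes>\<^sub>M lborel. f p = g p"
  shows "permuton_of f = permuton_of g"
  unfolding permuton_of_def
proof (rule density_cong)
  show "AE p in lborel_square. ennreal (f p) = ennreal (g p)"
    unfolding AE_restrict_space_iff[OF unit_square_lborel]
    using ae unfolding lborel_prod by eventually_elim simp
  show "(\<lambda>p. ennreal (f p)) \<in> borel_measurable lborel_square" "(\<lambda>p. ennreal (g p)) \<in> borel_measurable lborel_square"
    by (rule measurable_lborel_square, simp)+
qed

lemma measure_eqI_nn_integral:
  assumes "sets M = sets N" "\<And>A. A \<in> sets N \<Longrightarrow> (\<integral>\<^sup>+ x. indicator A x \<partial>M) = (\<integral>\<^sup>+ x. indicator A x \<partial>N)"
  shows "M = N"
  using assms by (intro measure_eqI) (auto simp flip: nn_integral_indicator)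

lemma uniform_01: "uniform_measure lborel {0..1::real} = density lborel (indicator {0..1})"
  by (simp add: uniform_measure_def divide_ennreal_def)

context copula_density
begin

lemma nn_permuton:
  "f \<in> borel_measurable (borel \<Otimes>\<^sub>M borel) \<Longrightarrow> (\<integral>\<^sup>+ p. f p \<partial>permuton_of g) = (\<integral>\<^sup>+ p. ennreal (g p) * f p \<partial>P)"
  by (rule nn_integral_permuton_of[OF meas outside])

lemma prob_space_permuton_of: "prob_space (permuton_of g)"
proof
  have "emeasure (permuton_of g) (space (permuton_of g)) = (\<integral>\<^sup>+ p. 1 \<partial>permuton_of g)" by simp
  also have "\<dots> = 1" by (subst nn_permuton) (simp_all add: nn_g)
  finally show "emeasure (permuton_of g) (space (permuton_of g)) = 1" .
qed

lemma permuton_permuton_of: "permuton (permuton_of g)"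
proof -
  have fst: "distr (permuton_of g) borel fst = uniform_measure lborel {0..1}"
    unfolding uniform_01
  proof (rule measure_eqI_nn_integral)
    fix A :: "real set" assume "A \<in> sets (density lborel (indicator {0..1}))"
    then have [measurable]: "A \<in> sets borel" by simp
    have "(\<integral>\<^sup>+ x. indicator A x \<partial>distr (permuton_of g) borel fst) = (\<integral>\<^sup>+ p. indicator A (fst p) \<partial>permuton_of g)"
      by (rule nn_integral_distr) (auto intro: measurable_permuton_of)
    also have "\<dots> = (\<integral>\<^sup>+ x. indicator {0..1} x * indicator A x \<partial>lborel)"
      by (subst nn_permuton, measurable) (subst nn_P, measurable, simp add: nn_integral_multc row)
    also have "\<dots> = (\<integral>\<^sup>+ x. indicator A x \<partial>density lborel (indicator {0..1}))"
      by (rule nn_integral_density[symmetric]) auto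
    finally show "(\<integral>\<^sup>+ x. indicator A x \<partial>distr (permuton_of g) borel fst) = (\<integral>\<^sup>+ x. indicator A x \<partial>density lborel (indicator {0..1}))" .
  qed simp
  have snd: "distr (permuton_of g) borel snd = uniform_measure lborel {0..1}"
    unfolding uniform_01
  proof (rule measure_eqI_nn_integral)
    fix A :: "real set" assume "A \<in> sets (density lborel (indicator {0..1}))"
    then have [measurable]: "A \<in> sets borel" by simp
    have "(\<integral>\<^sup>+ x. indicator A x \<partial>distr (permuton_of g) borel snd) = (\<integral>\<^sup>+ p. indicator A (snd p) \<partial>permuton_of g)"
      by (rule nn_integral_distr) (auto intro: measurable_permuton_of)
    also have "\<dots> = (\<integral>\<^sup>+ x. indicator {0..1} x * indicator A x \<partial>lborel)"
      by (subst nn_permuton, measurable) (subst nn_P', measurable, simp add: nn_integral_multc col)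
    also have "\<dots> = (\<integral>\<^sup>+ x. indicator A x \<partial>density lborel (indicator {0..1}))"
      by (rule nn_integral_density[symmetric]) auto
    finally show "(\<integral>\<^sup>+ x. indicator A x \<partial>distr (permuton_of g) borel snd) = (\<integral>\<^sup>+ x. indicator A x \<partial>density lborel (indicator {0..1}))" .
  qed simp
  show ?thesis
    unfolding permuton_def by (intro conjI prob_space_permuton_of sets_permuton_of fst snd)
qed

lemma ennreal_G_less:
  "(\<integral>\<^sup>+ q. (if fst q < x \<and> snd q < y then 1 else 0) \<partial>permuton_of g) = ennreal (G x y)"
proof -
  let ?L = "\<lambda>q :: real \<times> real. (if fst q < x \<and> snd q < y then 1 else 0 :: ennreal)"
  have L [measurable]: "?L \<in> borel_measurable (borel \<Otimes>\<^sub>M borel)"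
    by (rule measurable_If) auto
  have "(\<integral>\<^sup>+ q. ?L q \<partial>permuton_of g) = (\<integral>\<^sup>+ q. ennreal (g q) * ?L q \<partial>P)"
    by (rule nn_permuton[OF L])
  also have "\<dots> = (\<integral>\<^sup>+ v. \<integral>\<^sup>+ t. ennreal (g (t, v)) * ?L (t, v) \<partial>lborel \<partial>lborel)"
    using L by (intro nn_P' borel_measurable_times_ennreal) auto
  also have "\<dots> = (\<integral>\<^sup>+ v. \<integral>\<^sup>+ t. ennreal (g (t, v)) * (if t < x \<and> v < y then 1 else 0) \<partial>lborel \<partial>lborel)"
    by (simp only: fst_conv snd_conv)
  also have "\<dots> = (\<integral>\<^sup>+ v. \<integral>\<^sup>+ t. ennreal (g (t, v)) * (if t \<le> x \<and> v \<le> y then 1 else 0) \<partial>lborel \<partial>lborel)"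
  proof (rule nn_integral_cong_AE, use AE_lborel_singleton[of y] in eventually_elim)
    case (elim v)
    show ?case
      by (rule nn_integral_cong_AE, use AE_lborel_singleton[of x] in eventually_elim) (use elim in auto)
  qed
  finally show ?thesis by (simp add: ennreal_G_prod)
qed

text \<open>Exchanging the two points shows that the two parts of the event are equally likely. Given the first point
\<open>p\<close>, the second one lies below and to the left of it with probability \<open>G p\<close>.\<close>

lemma rho12_permuton_of: "rho12 (permuton_of g) = 2 * (\<integral>p. g p * G (fst p) (snd p) \<partial>P)"
proof -
  define M where "M = permuton_of g"
  interpret M: prob_space M unfolding M_def by (rule prob_space_permuton_of)
  interpret MM: pair_sigma_finite M M ..
  have f [measurable]: "fst \<in> borel_measurable M" "snd \<in> borel_measurable M"
    unfolding M_def by (auto intro: measurable_permuton_of)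
  let ?L = "\<lambda>q p. (if fst q < fst p \<and> snd q < snd p then 1 else 0 :: ennreal)"
  have mL [measurable]: "(\<lambda>z. ?L (fst z) (snd z)) \<in> borel_measurable (M \<Otimes>\<^sub>M M)"
    by measurable
  have mL' [measurable]: "(\<lambda>z. ?L (snd z) (fst z)) \<in> borel_measurable (M \<Otimes>\<^sub>M M)"
    by measurable
  let ?S = "{((x1, y1), (x2, y2)) \<in> space (M \<Otimes>\<^sub>M M). (x1 < x2 \<and> y1 < y2) \<or> (x2 < x1 \<and> y2 < y1)}"
  have S: "?S = {z \<in> space (M \<Otimes>\<^sub>M M). (fst (fst z) < fst (snd z) \<and> snd (fst z) < snd (snd z)) \<or> (fst (snd z) < fst (fst z) \<and> snd (snd z) < snd (fst z))}"
    by auto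
  have [measurable]: "?S \<in> sets (M \<Otimes>\<^sub>M M)" unfolding S by measurable
  have "emeasure (M \<Otimes>\<^sub>M M) ?S = (\<integral>\<^sup>+ z. indicator ?S z \<partial>(M \<Otimes>\<^sub>M M))"
    by simp
  also have "\<dots> = (\<integral>\<^sup>+ z. ?L (fst z) (snd z) + ?L (snd z) (fst z) \<partial>(M \<Otimes>\<^sub>M M))"
    by (intro nn_integral_cong) (auto split: split_indicator)
  also have "\<dots> = (\<integral>\<^sup>+ z. ?L (fst z) (snd z) \<partial>(M \<Otimes>\<^sub>M M)) + (\<integral>\<^sup>+ z. ?L (snd z) (fst z) \<partial>(M \<Otimes>\<^sub>M M))"
    by (rule nn_integral_add) measurable
  also have "(\<integral>\<^sup>+ z. ?L (fst z) (snd z) \<partial>(M \<Otimes>\<^sub>M M)) = (\<integral>\<^sup>+ p. \<integral>\<^sup>+ q. ?L q p \<partial>M \<partial>M)"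
    using MM.nn_integral_snd[OF mL] by simp
  also have "(\<integral>\<^sup>+ z. ?L (snd z) (fst z) \<partial>(M \<Otimes>\<^sub>M M)) = (\<integral>\<^sup>+ p. \<integral>\<^sup>+ q. ?L q p \<partial>M \<partial>M)"
    using M.nn_integral_fst[OF mL'] by simp
  also have "(\<integral>\<^sup>+ p. \<integral>\<^sup>+ q. ?L q p \<partial>M \<partial>M) = (\<integral>\<^sup>+ p. ennreal (G (fst p) (snd p)) \<partial>M)"
    unfolding M_def ennreal_G_less ..
  also have "\<dots> = (\<integral>\<^sup>+ p. ennreal (g p * G (fst p) (snd p)) \<partial>P)"
    unfolding M_def by (subst nn_permuton) (simp_all add: ennreal_mult nonneg)
  also have "\<dots> = ennreal (\<integral>p. g p * G (fst p) (snd p) \<partial>P)"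
    by (rule nn_integral_eq_integral[OF integrable_g_G]) (simp add: nonneg)
  finally have "emeasure (M \<Otimes>\<^sub>M M) ?S = ennreal (2 * (\<integral>p. g p * G (fst p) (snd p) \<partial>P))"
    by (simp add: integral_nonneg_AE nonneg flip: ennreal_plus)
  then show ?thesis
    unfolding rho12_def M_def[symmetric] by (simp add: measure_def integral_nonneg_AE nonneg)
qed

lemma permuton_entropy_permuton_of: "permuton_entropy (permuton_of g) = entropy_of P g"
proof -
  have "has_density (permuton_of g) g"
    unfolding has_density_def permuton_of_def using measurable_lborel_square[OF meas] nonneg by auto
  then show ?thesis by (simp add: permuton_entropy_eq density_entropy_eq[OF meas outside])
qed

end

lemma permuton_density_marginals:
  assumes perm: "permuton (permuton_of f)"
    and f [measurable]: "f \<in> borel_measurable (borel \<Otimes>\<^sub>M borel)" and out: "\<And>p. p \<notin> unit_square \<Longrightarrow> f p = 0"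
  shows "AE x in lborel. (\<integral>\<^sup>+ y. ennreal (f (x, y)) \<partial>lborel) = indicator {0..1} x"
    and "AE y in lborel. (\<integral>\<^sup>+ x. ennreal (f (x, y)) \<partial>lborel) = indicator {0..1} y"
proof -
  have 1: "density lborel (\<lambda>x. \<integral>\<^sup>+ y. ennreal (f (x, y)) \<partial>lborel) = distr (permuton_of f) borel fst"
  proof (rule measure_eqI_nn_integral)
    fix A :: "real set" assume "A \<in> sets (distr (permuton_of f) borel fst)"
    then have [measurable]: "A \<in> sets borel" by simp
    have "(\<integral>\<^sup>+ x. indicator A x \<partial>distr (permuton_of f) borel fst) = (\<integral>\<^sup>+ p. indicator A (fst p) \<partial>permuton_of f)"
      by (rule nn_integral_distr) (auto intro: measurable_permuton_of)
    also have "\<dots> = (\<integral>\<^sup>+ p. ennreal (f p) * indicator A (fst p) \<partial>(lborel \<Otimes>\<^sub>M lborel))"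
      by (rule nn_integral_permuton_of[OF f out]) measurable
    also have "\<dots> = (\<integral>\<^sup>+ x. (\<integral>\<^sup>+ y. ennreal (f (x, y)) \<partial>lborel) * indicator A x \<partial>lborel)"
      by (subst lborel.nn_integral_fst[symmetric], measurable, simp add: nn_integral_multc)
    also have "\<dots> = (\<integral>\<^sup>+ x. indicator A x \<partial>density lborel (\<lambda>x. \<integral>\<^sup>+ y. ennreal (f (x, y)) \<partial>lborel))"
      by (rule nn_integral_density[symmetric]) measurable
    finally show "(\<integral>\<^sup>+ x. indicator A x \<partial>density lborel (\<lambda>x. \<integral>\<^sup>+ y. ennreal (f (x, y)) \<partial>lborel)) = (\<integral>\<^sup>+ x. indicator A x \<partial>distr (permuton_of f) borel fst)" ..
  qed simp
  have 2: "density lborel (\<lambda>y. \<integral>\<^sup>+ x. ennreal (f (x, y)) \<partial>lborel) = distr (permuton_of f) borel snd"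
  proof (rule measure_eqI_nn_integral)
    fix A :: "real set" assume "A \<in> sets (distr (permuton_of f) borel snd)"
    then have [measurable]: "A \<in> sets borel" by simp
    have "(\<integral>\<^sup>+ x. indicator A x \<partial>distr (permuton_of f) borel snd) = (\<integral>\<^sup>+ p. indicator A (snd p) \<partial>permuton_of f)"
      by (rule nn_integral_distr) (auto intro: measurable_permuton_of)
    also have "\<dots> = (\<integral>\<^sup>+ p. ennreal (f p) * indicator A (snd p) \<partial>(lborel \<Otimes>\<^sub>M lborel))"
      by (rule nn_integral_permuton_of[OF f out]) measurable
    also have "\<dots> = (\<integral>\<^sup>+ x. (\<integral>\<^sup>+ y. ennreal (f (y, x)) \<partial>lborel) * indicator A x \<partial>lborel)"
      by (subst lborel_pair.nn_integral_snd[symmetric], measurable, simp add: nn_integral_multc)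
    also have "\<dots> = (\<integral>\<^sup>+ x. indicator A x \<partial>density lborel (\<lambda>x. \<integral>\<^sup>+ y. ennreal (f (y, x)) \<partial>lborel))"
      by (rule nn_integral_density[symmetric]) measurable
    finally show "(\<integral>\<^sup>+ x. indicator A x \<partial>density lborel (\<lambda>x. \<integral>\<^sup>+ y. ennreal (f (y, x)) \<partial>lborel)) = (\<integral>\<^sup>+ x. indicator A x \<partial>distr (permuton_of f) borel snd)" ..
  qed simp
  note u = sigma_finite_measure.density_unique_iff[OF sigma_finite_lborel, THEN iffD1]
  show "AE x in lborel. (\<integral>\<^sup>+ y. ennreal (f (x, y)) \<partial>lborel) = indicator {0..1} x"
    by (rule u) (use perm in \<open>auto simp: 1 permuton_def uniform_01\<close>)
  show "AE y in lborel. (\<integral>\<^sup>+ x. ennreal (f (x, y)) \<partial>lborel) = indicator {0..1} y"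
    by (rule u) (use perm in \<open>auto simp: 2 permuton_def uniform_01\<close>)
qed

text \<open>The marginals of a density of \<open>\<gamma>\<close> are uniform off null sets \<open>X\<close> and \<open>Y\<close>. Replacing the density by \<open>1\<close> on the
lines through \<open>X\<close> and \<open>Y\<close> repairs the exceptional sections, and changes each other section on a null set only.\<close>

lemma permuton_copula_density:
  assumes perm: "permuton \<gamma>" and dens: "has_density \<gamma> f"
  obtains g where "copula_density g" "\<gamma> = permuton_of g"
proof -
  define f0 where "f0 p = f p * indicator unit_square p" for p
  have f0 [measurable]: "f0 \<in> borel_measurable (borel \<Otimes>\<^sub>M borel)"
  proof -
    have "f \<in> borel_measurable lborel_square" using dens by (simp add: has_density_def)
    then have "(\<lambda>p. indicator unit_square p *\<^sub>R f p) \<in> borel_measurable (lborel :: (real \<times> real) measure)"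
      by (simp only: borel_measurable_restrict_space_iff[OF unit_square_lborel])
    then have "f0 \<in> borel_measurable (lborel :: (real \<times> real) measure)"
      by (simp add: f0_def[abs_def] mult.commute)
    then show ?thesis by (simp only: measurable_cong_sets[OF sets_lborel_pair refl])
  qed
  have out: "p \<notin> unit_square \<Longrightarrow> f0 p = 0" for p by (simp add: f0_def)
  have nn: "0 \<le> f0 p" for p using dens by (auto simp: f0_def has_density_def split: split_indicator)
  have \<gamma>: "\<gamma> = permuton_of f0"
  proof -
    have "\<gamma> = density lborel_square (\<lambda>p. ennreal (f p))" using dens by (simp add: has_density_def)
    also have "\<dots> = density lborel_square (\<lambda>p. ennreal (f0 p))"
    proof (rule density_cong)
      show "(\<lambda>p. ennreal (f p)) \<in> borel_measurable lborel_square"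
        using dens unfolding has_density_def by (intro measurable_compose[OF _ measurable_ennreal]) blast
      show "(\<lambda>p. ennreal (f0 p)) \<in> borel_measurable lborel_square"
        by (rule measurable_lborel_square) measurable
      show "AE p in lborel_square. ennreal (f p) = ennreal (f0 p)"
        by (rule AE_I2) (simp add: f0_def space_restrict_space)
    qed
    finally show ?thesis by (simp add: permuton_of_def)
  qed
  note marg = permuton_density_marginals[OF perm[unfolded \<gamma>] f0 out]
  define X where "X = {x. (\<integral>\<^sup>+ y. ennreal (f0 (x, y)) \<partial>lborel) \<noteq> indicator {0..1} x}"
  define Y where "Y = {y. (\<integral>\<^sup>+ x. ennreal (f0 (x, y)) \<partial>lborel) \<noteq> indicator {0..1} y}"
  have [measurable]: "X \<in> sets borel" "Y \<in> sets borel" unfolding X_def Y_def by measurable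
  have aeX: "AE x in lborel. x \<notin> X" using marg(1) by (simp add: X_def)
  have aeY: "AE y in lborel. y \<notin> Y" using marg(2) by (simp add: Y_def)
  define g where "g = (\<lambda>(x, y). if x \<in> X \<or> y \<in> Y then indicator unit_square (x, y) else f0 (x, y))"
  have g [measurable]: "g \<in> borel_measurable (borel \<Otimes>\<^sub>M borel)" unfolding g_def by measurable
  have "copula_density g"
  proof
    show "g \<in> borel_measurable (borel \<Otimes>\<^sub>M borel)" by (rule g)
    show "0 \<le> g p" for p by (cases p) (simp add: g_def nn)
    show "p \<notin> unit_square \<Longrightarrow> g p = 0" for p by (cases p) (auto simp: g_def out)
    show "(\<integral>\<^sup>+ y. ennreal (g (x, y)) \<partial>lborel) = indicator {0..1} x" for x
    proof (cases "x \<in> X")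
      case True
      have "(\<integral>\<^sup>+ y. ennreal (g (x, y)) \<partial>lborel) = (\<integral>\<^sup>+ y. indicator {0..1} x * indicator {0..1} y \<partial>(lborel :: real measure))"
        using True by (intro nn_integral_cong) (auto simp: g_def split: split_indicator)
      then show ?thesis by (simp add: nn_integral_cmult)
    next
      case False
      have "(\<integral>\<^sup>+ y. ennreal (g (x, y)) \<partial>lborel) = (\<integral>\<^sup>+ y. ennreal (f0 (x, y)) \<partial>lborel)"
        using aeY False by (intro nn_integral_cong_AE) (auto simp: g_def elim!: eventually_mono)
      then show ?thesis using False by (simp add: X_def)
    qed
    show "(\<integral>\<^sup>+ x. ennreal (g (x, y)) \<partial>lborel) = indicator {0..1} y" for y
    proof (cases "y \<in> Y")
      case True
      have "(\<integral>\<^sup>+ x. ennreal (g (x, y)) \<partial>lborel) = (\<integral>\<^sup>+ x. indicator {0..1} y * indicator {0..1} x \<partial>(lborel :: real measure))"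
        using True by (intro nn_integral_cong) (auto simp: g_def split: split_indicator)
      then show ?thesis by (simp add: nn_integral_cmult)
    next
      case False
      have "(\<integral>\<^sup>+ x. ennreal (g (x, y)) \<partial>lborel) = (\<integral>\<^sup>+ x. ennreal (f0 (x, y)) \<partial>lborel)"
        using aeX False by (intro nn_integral_cong_AE) (auto simp: g_def elim!: eventually_mono)
      then show ?thesis using False by (simp add: Y_def)
    qed
  qed
  moreover have "AE p in lborel \<Otimes>\<^sub>M lborel. f0 p = g p"
  proof (rule lborel_pair.AE_pair_measure)
    show "AE x in lborel. AE y in lborel. f0 (x, y) = g (x, y)"
      using aeX by eventually_elim (use aeY in \<open>auto simp: g_def elim!: eventually_mono\<close>)
  qed measurable
  then have "\<gamma> = permuton_of g" unfolding \<gamma> by (intro permuton_of_cong_AE) measurable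
  ultimately show ?thesis by (rule that)
qed

section \<open>The entropy maximizer\<close>

lemma rho12_frank: "rho12 (permuton_of (frank_g r)) = rho_real r"
  using frank.rho12_permuton_of[of r] frank.extremal_integral_G[OF frank_extremal[of r]] by simp

lemma entropy_frank: "permuton_entropy (permuton_of (frank_g r)) = ereal (entropy_const r + r * rho_real r / 2)"
  using frank.entropy_bound(2)[of r r] frank_extremal[of r] frank.extremal_integral_G[OF frank_extremal[of r]]
  by (simp add: frank.permuton_entropy_permuton_of)

text \<open>At the prescribed value of \<open>rho12\<close> the entropy bound for \<open>\<gamma>\<close> with parameter \<open>r\<close> is the entropy of the Frank
copula, for which the bound is an equality.\<close>

lemma entropy_le_frank:
  assumes "permuton \<gamma>" "rho12 \<gamma> = rho_real r"
  shows "permuton_entropy \<gamma> \<le> permuton_entropy (permuton_of (frank_g r))"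
    and "permuton_entropy \<gamma> = permuton_entropy (permuton_of (frank_g r)) \<Longrightarrow> \<gamma> = permuton_of (frank_g r)"
proof -
  have "permuton_entropy \<gamma> \<le> permuton_entropy (permuton_of (frank_g r)) \<and>
    (permuton_entropy \<gamma> = permuton_entropy (permuton_of (frank_g r)) \<longrightarrow> \<gamma> = permuton_of (frank_g r))"
  proof (cases "\<exists>f. has_density \<gamma> f")
    case False
    then have "permuton_entropy \<gamma> = - \<infinity>" by (simp add: permuton_entropy_def)
    then show ?thesis by (simp add: entropy_frank)
  next
    case True
    then obtain g where g: "copula_density g" "\<gamma> = permuton_of g"
      using permuton_copula_density[OF assms(1)] by blast
    interpret g: copula_density g by fact
    have I: "(\<integral>p. g p * g.G (fst p) (snd p) \<partial>g.P) = rho_real r / 2"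
      using assms(2) g.rho12_permuton_of g(2) by simp
    have "permuton_entropy \<gamma> \<le> permuton_entropy (permuton_of (frank_g r))"
      using g.entropy_bound(1)[of r] by (simp add: I g(2) g.permuton_entropy_permuton_of entropy_frank)
    moreover have "\<gamma> = permuton_of (frank_g r)" if "permuton_entropy \<gamma> = permuton_entropy (permuton_of (frank_g r))"
    proof -
      have "AE p in g.P. g p = g.h r p"
        using that g.entropy_bound(2)[of r] by (simp add: I g(2) g.permuton_entropy_permuton_of entropy_frank)
      then have "AE p in g.P. g p = frank_g r p"
        using extremal_unique[OF g(1) copula_frank] frank_extremal by blast
      then show ?thesis
        unfolding g(2) by (rule permuton_of_cong_AE[OF g.meas frank.meas])
    qed
    ultimately show ?thesis by blast
  qed
  then show "permuton_entropy \<gamma> \<le> permuton_entropy (permuton_of (frank_g r))"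
    "permuton_entropy \<gamma> = permuton_entropy (permuton_of (frank_g r)) \<Longrightarrow> \<gamma> = permuton_of (frank_g r)"
    by blast+
qed

lemma has_density_max_density: "has_density (permuton_of (frank_g r)) (max_density r)"
proof -
  have eq: "max_density r = (\<lambda>p. frank_density r (fst p) (snd p))"
    by (auto simp: fun_eq_iff max_density_eq)
  have m: "max_density r \<in> borel_measurable (borel \<Otimes>\<^sub>M borel)" unfolding eq by measurable
  have "permuton_of (frank_g r) = density lborel_square (\<lambda>p. ennreal (max_density r p))"
    unfolding permuton_of_def
  proof (rule density_cong)
    show "(\<lambda>p. ennreal (frank_g r p)) \<in> borel_measurable lborel_square"
      using frank.meas[of r] by (intro measurable_lborel_square) simp
    show "(\<lambda>p. ennreal (max_density r p)) \<in> borel_measurable lborel_square"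
      using m by (intro measurable_lborel_square) simp
    show "AE p in lborel_square. ennreal (frank_g r p) = ennreal (max_density r p)"
      by (rule AE_I2) (auto simp: eq frank_g_def space_restrict_space)
  qed
  then show ?thesis
    unfolding has_density_def using measurable_lborel_square[OF m] by (simp add: eq frank_density_nonneg)
qed

theorem mainTheorem4:
  fixes \<rho> :: real
  assumes "0 < \<rho>" and "\<rho> < 1"
  shows "(\<exists>!r. rho_param r = complex_of_real \<rho>) \<and>
         (\<exists>!\<gamma>. entropy_maximizer \<rho> \<gamma>) \<and>
         (\<forall>r \<gamma>. rho_param r = complex_of_real \<rho> \<longrightarrow> entropy_maximizer \<rho> \<gamma> \<longrightarrow>
            has_density \<gamma> (max_density r))"
proof -
  have ex1: "\<exists>!r. rho_param r = complex_of_real \<rho>"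
    using ex1_rho_real[OF assms] by (simp add: rho_param_eq)
  have max: "entropy_maximizer \<rho> \<gamma> \<longleftrightarrow> \<gamma> = permuton_of (frank_g r)" if "rho_param r = complex_of_real \<rho>" for r \<gamma>
  proof -
    have r: "rho_real r = \<rho>" using that by (simp add: rho_param_eq)
    have M: "entropy_maximizer \<rho> (permuton_of (frank_g r))"
      unfolding entropy_maximizer_def
      using frank.permuton_permuton_of rho12_frank entropy_le_frank(1) r by auto
    show ?thesis
    proof
      assume \<gamma>: "entropy_maximizer \<rho> \<gamma>"
      then have p: "permuton \<gamma>" "rho12 \<gamma> = rho_real r" by (auto simp: entropy_maximizer_def r)
      have "permuton_entropy (permuton_of (frank_g r)) \<le> permuton_entropy \<gamma>"
        using \<gamma> M unfolding entropy_maximizer_def by blast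
      then show "\<gamma> = permuton_of (frank_g r)"
        using entropy_le_frank[OF p] by (intro entropy_le_frank(2)[OF p] antisym)
    qed (use M in simp)
  qed
  from ex1 obtain r where r: "rho_param r = complex_of_real \<rho>" by blast
  show ?thesis
    using ex1 max[OF r] max has_density_max_density by auto
qed

end
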